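(* Let $q\ge 3$ be odd, $d\ge 2$, and let $\sigma$ be a non-degenerate quadratic form on $\mathbb{F}_q^n$ defining a polar space of type $O(2d+1,q)$ (with $n=2d+1$), $O^+(2d,q)$ or $O^-(2d,q)$ (with $n=2d$); let $\perp$ be the associated polarity. Let $V_+$ (resp. $V_-$) be the set of points $\langle v\rangle$ with $\sigma(v)$ a nonzero square (resp. a non-square) in $\mathbb{F}_q$, fix $\epsilon\in\{+,-\}$, and let $\Gamma_\epsilon$ be the graph with vertex set $V_\epsilon$, two points $x,y$ adjacent iff $x\subseteq y^\perp$. Let $3\le m\le d$ and let $L_1,L_2$ be $(m-1)$-dimensional subspaces, not totally isotropic, such that $p:=L_1\cap L_2$ has dimension $m-2$ and $p=L_1\cap L_1^\perp=L_2\cap L_2^\perp$; put $P=L_1+L_2$. Let $C_1$ be the set of points of $L_1$ not in $L_2$ and $C_2$ the set of points of $L_2$ not in $L_1$, and suppose all points of $C_1\cup C_2$ lie in $V_\epsilon$. Then: (i) $\{C_1,C_2\}$ is a switching set of $\Gamma_\epsilon$. (ii) Let $\delta=-$ if $q\equiv 3\pmod 4$ and $\delta=+$ if $q\equiv 1\pmod 4$. If $m=3$, $P/p$ with the induced form is isomorphic to $O^\delta(2,q)$, and $n\ge 7$, then the graph $\overline{\Gamma}_\epsilon$ obtained from $\Gamma_\epsilon$ by switching with respect to $\{C_1,C_2\}$ is not isomorphic to $\Gamma_\epsilon$.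
   Context: Points are $1$-dimensional subspaces. $O^+(2,q)$ (resp. $O^-(2,q)$) denotes a non-degenerate $2$-dimensional quadratic space containing (resp. not containing) nonzero singular vectors. For a vertex $x$, $\Gamma(x)$ is its neighbourhood. For disjoint vertex sets $C_1,C_2$ of a graph $\Gamma$ with $D$ the remaining vertices: $\{C_1,C_2\}$ is a switching set if $|C_1|=|C_2|$, the induced subgraphs on $C_1$, $C_2$, $C_1\cup C_2$ are regular with equal degrees on $C_1$ and $C_2$, and every $x\in D$ satisfies $|\Gamma(x)\cap C_1|=|\Gamma(x)\cap C_2|$ or $\Gamma(x)\cap(C_1\cup C_2)\in\{C_1,C_2\}$. The graph $\overline{\Gamma}$ obtained by switching has the same vertices, the same edges inside $C_1\cup C_2$ and inside $D$, and for $x\in D$: $\overline{\Gamma}(x)\cap(C_1\cup C_2)$ equals $C_1$ if $\Gamma(x)\cap(C_1\cup C_2)=C_2$, equals $C_2$ if $\Gamma(x)\cap(C_1\cup C_2)=C_1$, and equals $\Gamma(x)\cap(C_1\cup C_2)$ otherwise. *)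

theory Defs
  imports "HOL-Analysis.Analysis" "HOL-Library.Set_Algebras"
begin

subsection \<open>Quadratic forms\<close>

definition polar :: "('a::field ^ 'n \<Rightarrow> 'a) \<Rightarrow> 'a ^ 'n \<Rightarrow> 'a ^ 'n \<Rightarrow> 'a" where
  "polar \<sigma> u v = \<sigma> (u + v) - \<sigma> u - \<sigma> v"

definition quadratic_form :: "('a::field ^ 'n \<Rightarrow> 'a) \<Rightarrow> bool" where
  "quadratic_form \<sigma> \<longleftrightarrow>
     (\<forall>c v. \<sigma> (c *s v) = c\<^sup>2 * \<sigma> v) \<and>
     (\<forall>u. Vector_Spaces.linear (*s) (*) (\<lambda>v. polar \<sigma> u v)) \<and>
     (\<forall>v. Vector_Spaces.linear (*s) (*) (\<lambda>u. polar \<sigma> u v))"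

definition perp :: "('a::field ^ 'n \<Rightarrow> 'a) \<Rightarrow> ('a ^ 'n) set \<Rightarrow> ('a ^ 'n) set" where
  "perp \<sigma> S = {v. \<forall>s\<in>S. polar \<sigma> v s = 0}"

text \<open>Only used in odd characteristic, where a trivial radical of the polar form is the usual
  notion of non-degeneracy.\<close>

definition nondegenerate :: "('a::field ^ 'n \<Rightarrow> 'a) \<Rightarrow> bool" where
  "nondegenerate \<sigma> \<longleftrightarrow> perp \<sigma> UNIV = {0}"

definition totally_isotropic :: "('a::field ^ 'n \<Rightarrow> 'a) \<Rightarrow> ('a ^ 'n) set \<Rightarrow> bool" where
  "totally_isotropic \<sigma> S \<longleftrightarrow> S \<subseteq> perp \<sigma> S"

definition totally_singular :: "('a::field ^ 'n \<Rightarrow> 'a) \<Rightarrow> ('a ^ 'n) set \<Rightarrow> bool" where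
  "totally_singular \<sigma> S \<longleftrightarrow> (\<forall>v\<in>S. \<sigma> v = 0)"

definition witt_index :: "('a::field ^ 'n \<Rightarrow> 'a) \<Rightarrow> nat" where
  "witt_index \<sigma> = Max {vec.dim S | S. vec.subspace S \<and> totally_singular \<sigma> S}"

text \<open>The types \<open>O(2d+1,q)\<close>, \<open>O\<^sup>+(2d,q)\<close> and \<open>O\<^sup>-(2d,q)\<close>, where \<open>q\<close> is the order of the field.
  In odd dimension over a finite field of odd order the polar space is determined by the dimension;
  in even dimension the two types are told apart by the Witt index.\<close>

definition type_O_odd :: "nat \<Rightarrow> ('a::field ^ 'n \<Rightarrow> 'a) \<Rightarrow> bool" where
  "type_O_odd d \<sigma> \<longleftrightarrow> quadratic_form \<sigma> \<and> nondegenerate \<sigma> \<and>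
     CARD('n) = 2 * d + 1"

definition type_O_plus :: "nat \<Rightarrow> ('a::field ^ 'n \<Rightarrow> 'a) \<Rightarrow> bool" where
  "type_O_plus d \<sigma> \<longleftrightarrow> quadratic_form \<sigma> \<and> nondegenerate \<sigma> \<and>
     CARD('n) = 2 * d \<and> witt_index \<sigma> = d"

definition type_O_minus :: "nat \<Rightarrow> ('a::field ^ 'n \<Rightarrow> 'a) \<Rightarrow> bool" where
  "type_O_minus d \<sigma> \<longleftrightarrow> quadratic_form \<sigma> \<and> nondegenerate \<sigma> \<and>
     CARD('n) = 2 * d \<and> witt_index \<sigma> + 1 = d"

datatype sign = Pos | Neg

text \<open>A quadratic form on the plane making it an \<open>O\<^sup>+(2,q)\<close> or an \<open>O\<^sup>-(2,q)\<close>.\<close>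

definition type_O2 :: "sign \<Rightarrow> ('a::field ^ 2 \<Rightarrow> 'a) \<Rightarrow> bool" where
  "type_O2 s \<tau> \<longleftrightarrow> quadratic_form \<tau> \<and> nondegenerate \<tau> \<and>
     (case s of Pos \<Rightarrow> \<exists>v. v \<noteq> 0 \<and> \<tau> v = 0 | Neg \<Rightarrow> \<not> (\<exists>v. v \<noteq> 0 \<and> \<tau> v = 0))"

text \<open>The quotient \<open>P/p\<close> is the set of cosets \<open>v +o p\<close> with \<open>v\<close> in \<open>P\<close>; its operations and the
  induced form are those of representatives. The map \<open>\<phi>\<close> is a linear isometry from \<open>P/p\<close> onto
  the quadratic space given by \<open>\<tau>\<close>.\<close>

definition quotient_isometric ::
  "('a::field ^ 'n \<Rightarrow> 'a) \<Rightarrow> ('a ^ 'n) set \<Rightarrow> ('a ^ 'n) set \<Rightarrow> ('a ^ 'k \<Rightarrow> 'a) \<Rightarrow> bool" where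
  "quotient_isometric \<sigma> P p \<tau> \<longleftrightarrow>
     (\<exists>\<phi>. bij_betw \<phi> ((\<lambda>v. v +o p) ` P) UNIV \<and>
       (\<forall>u\<in>P. \<forall>v\<in>P. \<phi> ((u + v) +o p) = \<phi> (u +o p) + \<phi> (v +o p)) \<and>
       (\<forall>c. \<forall>v\<in>P. \<phi> ((c *s v) +o p) = c *s \<phi> (v +o p)) \<and>
       (\<forall>v\<in>P. \<tau> (\<phi> (v +o p)) = \<sigma> v))"

definition points :: "('a::field ^ 'n) set set" where
  "points = {x. vec.subspace x \<and> vec.dim x = 1}"

definition points_of_sign :: "('a::field ^ 'n \<Rightarrow> 'a) \<Rightarrow> sign \<Rightarrow> ('a ^ 'n) set set" where
  "points_of_sign \<sigma> \<epsilon> = (case \<epsilon> of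
      Pos \<Rightarrow> {vec.span {v} | v. \<sigma> v \<noteq> 0 \<and> (\<exists>a. \<sigma> v = a\<^sup>2)}
    | Neg \<Rightarrow> {vec.span {v} | v. \<not> (\<exists>a. \<sigma> v = a\<^sup>2)})"


subsection \<open>Graphs and switching\<close>

text \<open>Only the restriction of \<open>adj\<close> to \<open>verts\<close> is meaningful.\<close>

record 'v graph =
  verts :: "'v set"
  adj :: "'v \<Rightarrow> 'v \<Rightarrow> bool"

definition nbhd :: "'v graph \<Rightarrow> 'v \<Rightarrow> 'v set" where
  "nbhd G x = {y \<in> verts G. adj G x y}"

definition graph_iso :: "'v graph \<Rightarrow> 'w graph \<Rightarrow> bool" where
  "graph_iso G H \<longleftrightarrow> (\<exists>f. bij_betw f (verts G) (verts H) \<and>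
     (\<forall>x\<in>verts G. \<forall>y\<in>verts G. adj G x y \<longleftrightarrow> adj H (f x) (f y)))"

definition induced_regular :: "'v graph \<Rightarrow> 'v set \<Rightarrow> nat \<Rightarrow> bool" where
  "induced_regular G S k \<longleftrightarrow> (\<forall>x\<in>S. card (nbhd G x \<inter> S) = k)"

definition switching_set :: "'v graph \<Rightarrow> 'v set \<Rightarrow> 'v set \<Rightarrow> bool" where
  "switching_set G C\<^sub>1 C\<^sub>2 \<longleftrightarrow>
     finite (verts G) \<and> C\<^sub>1 \<subseteq> verts G \<and> C\<^sub>2 \<subseteq> verts G \<and> C\<^sub>1 \<inter> C\<^sub>2 = {} \<and>
     card C\<^sub>1 = card C\<^sub>2 \<and>
     (\<exists>k. induced_regular G C\<^sub>1 k \<and> induced_regular G C\<^sub>2 k) \<and>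
     (\<exists>l. induced_regular G (C\<^sub>1 \<union> C\<^sub>2) l) \<and>
     (\<forall>x \<in> verts G - (C\<^sub>1 \<union> C\<^sub>2).
        card (nbhd G x \<inter> C\<^sub>1) = card (nbhd G x \<inter> C\<^sub>2) \<or>
        nbhd G x \<inter> (C\<^sub>1 \<union> C\<^sub>2) \<in> {C\<^sub>1, C\<^sub>2})"

definition switched_nbhd :: "'v graph \<Rightarrow> 'v set \<Rightarrow> 'v set \<Rightarrow> 'v \<Rightarrow> 'v set" where
  "switched_nbhd G C\<^sub>1 C\<^sub>2 x =
     (let N = nbhd G x \<inter> (C\<^sub>1 \<union> C\<^sub>2)
      in if N = C\<^sub>2 then C\<^sub>1 else if N = C\<^sub>1 then C\<^sub>2 else N)"

definition switch :: "'v graph \<Rightarrow> 'v set \<Rightarrow> 'v set \<Rightarrow> 'v graph" where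
  "switch G C\<^sub>1 C\<^sub>2 =
     \<lparr>verts = verts G,
      adj = (\<lambda>x y.
        let C = C\<^sub>1 \<union> C\<^sub>2; D = verts G - C in
        if x \<in> D \<and> y \<in> C then y \<in> switched_nbhd G C\<^sub>1 C\<^sub>2 x
        else if x \<in> C \<and> y \<in> D then x \<in> switched_nbhd G C\<^sub>1 C\<^sub>2 y
        else adj G x y)\<rparr>"

text \<open>There are no loops in odd characteristic, since a vertex is never contained in its own
  perpendicular space.\<close>

definition polar_graph :: "('a::field ^ 'n \<Rightarrow> 'a) \<Rightarrow> sign \<Rightarrow> ('a ^ 'n) set graph" where
  "polar_graph \<sigma> \<epsilon> = \<lparr>verts = points_of_sign \<sigma> \<epsilon>, adj = (\<lambda>x y. x \<subseteq> perp \<sigma> y)\<rparr>"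

end

theory Submission
  imports Defs "HOL-Computational_Algebra.Nth_Powers" "HOL-Library.Z2"
begin

text \<open>
  Write \<open>bil\<close> for half the polar form, \<open>p = L\<^sub>1 \<inter> L\<^sub>2\<close> and \<open>L\<^sub>i = p + \<langle>v\<^sub>i\<rangle>\<close>, where \<open>v\<^sub>1\<close> and
  \<open>v\<^sub>2\<close> have the same value \<open>e\<close>; then \<open>C\<^sub>i\<close> consists of the points \<open>\<langle>v\<^sub>i + w\<rangle>\<close> with \<open>w \<in> p\<close>. A vector \<open>u\<close>
  perpendicular to \<open>p\<close> sees all or nothing of \<open>C\<^sub>i\<close>; for any other \<open>u\<close> the solutions \<open>w \<in> p\<close> of
  \<open>bil u (v\<^sub>i + w) = 0\<close> form a fibre of a nonzero functional on \<open>p\<close>. This gives the switching set.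

  For the second part, products of reflections act transitively on the orthogonal frames with given
  values, so in \<open>\<Gamma>\<close> the number of common neighbours of a clique depends on its size only. This fails
  for some cliques of size \<open>n - 3\<close> of the switched graph \<open>\<Gamma>'\<close>. Write \<open>p = \<langle>z + z'\<rangle>\<close> with
  \<open>z \<bottom> z'\<close> of values \<open>e\<close> and \<open>- e\<close> and \<open>v\<^sub>1, v\<^sub>2 \<bottom> z\<close>. The type of \<open>P/p\<close> says that
  \<open>v\<^sub>1 = a v\<^sub>2 + r v'\<close> with \<open>v' \<bottom> v\<^sub>2\<close> of value \<open>e\<close>, \<open>a\<^sup>2 + r\<^sup>2 = 1\<close> and \<open>r \<noteq> 0\<close>. Take \<open>n - 5\<close>
  orthogonal vectors \<open>ys\<close> of value \<open>e\<close> in \<open>{z, z', v\<^sub>2}\<^sup>\<bottom>\<close>. Then \<open>{v\<^sub>2, z} \<union> ys\<close> is a clique of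
  \<open>\<Gamma>\<close> and \<open>{v\<^sub>1, z} \<union> ys\<close> one of \<open>\<Gamma>'\<close>. They have the same common neighbours perpendicular to
  \<open>p\<close>, and the others correspond, up to sign, to the solutions of \<open>\<alpha> i\<^sup>2 + \<beta> j\<^sup>2 - t\<^sup>2 = 1\<close>,
  \<open>t \<noteq> 0\<close>, for two binary forms \<open>(\<alpha>, \<beta>)\<close> whose discriminants differ by the factor
  \<open>a\<^sup>2 + r\<^sup>2 s\<close>, where \<open>s e\<close> is the value of the component of \<open>v'\<close> perpendicular to \<open>ys\<close>. If this
  factor is a non-square, the two numbers of solutions differ. Since \<open>n - 5 \<ge> 2\<close> and \<open>1 - s\<close> is a
  sum of two squares, \<open>ys\<close> can be chosen with any prescribed \<open>s \<noteq> 0\<close>.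
\<close>


subsection \<open>Squares and quadrics over a finite field of odd order\<close>

lemma card_two_to_one_image:
  assumes "finite X"
    and invol: "\<And>x. x \<in> X \<Longrightarrow> h x \<in> X \<and> h x \<noteq> x"
    and fibre: "\<And>x y. x \<in> X \<Longrightarrow> y \<in> X \<Longrightarrow> f x = f y \<longleftrightarrow> y = x \<or> y = h x"
  shows "card X = 2 * card (f ` X)"
proof -
  have "card {y \<in> X. f y = z} = 2" if z: "z \<in> f ` X" for z
  proof -
    obtain x where x: "x \<in> X" "z = f x" using z by blast
    have "{y \<in> X. f y = z} = {x, h x}"
      using x fibre[OF x(1)] invol[OF x(1)] by fastforce
    then show ?thesis using invol[OF x(1)] by auto
  qed
  then show ?thesis
    using sum.image_gen[OF assms(1), of "\<lambda>_. 1::nat" f] by simp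
qed

lemma even_card_iff_even_card_fixed_points:
  assumes "finite A" and invol: "\<And>x. x \<in> A \<Longrightarrow> h x \<in> A \<and> h (h x) = x"
  shows "even (card A) \<longleftrightarrow> even (card {x \<in> A. h x = x})"
proof -
  let ?M = "{x \<in> A. h x \<noteq> x}"
  have "(\<Sum>x\<in>?M. 1 :: bit) = 0"
    by (rule sum_involution_eq_0[where h = h]) (use invol in auto)
  then have "even (of_nat (card ?M) :: bit)" by simp
  then have "even (card ?M)" by (simp only: even_of_nat_iff)
  moreover have "card A = card ?M + card {x \<in> A. h x = x}"
    using assms(1) by (subst card_Un_disjoint[symmetric]) (auto intro: arg_cong[where f = card])
  ultimately show ?thesis by simp
qed

lemma two_neq_zero_if_odd_card:
  assumes "odd CARD('a::{field,finite})"
  shows "(2::'a) \<noteq> 0"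
proof
  assume "(2::'a) = 0"
  then have "x + 1 + 1 = x" for x :: 'a
    by (metis add.assoc add.right_neutral one_add_one)
  then have "even CARD('a)"
    by (subst even_card_iff_even_card_fixed_points[where h = "\<lambda>x. x + 1"]) auto
  with assms show False by simp
qed

lemma uminus_eq_self_iff:
  fixes x :: "'a::field"
  assumes "(2::'a) \<noteq> 0"
  shows "- x = x \<longleftrightarrow> x = 0"
proof
  assume "- x = x"
  then have "2 * x = 0" by (metis add.right_inverse mult_2)
  with assms show "x = 0" by simp
qed simp

lemma is_square_mult_cancel_left:
  fixes x y :: "'a::field"
  assumes "is_square x" "x \<noteq> 0"
  shows "is_square (x * y) \<longleftrightarrow> is_square y"
proof
  assume "is_square (x * y)"
  with assms(1) obtain r s where "x = r\<^sup>2" "x * y = s\<^sup>2" by (auto elim!: is_nth_powerE)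
  with assms(2) have "y = (s / r)\<^sup>2" by (simp add: field_simps)
  then show "is_square y" ..
qed (rule is_nth_power_mult[OF assms(1)])

lemma card_prod_eq:
  fixes c :: "'a::{field,finite}"
  shows "card {(r, s). r * s = c} = CARD('a) - 1 + (if c = 0 then CARD('a) else 0)"
proof -
  have "{(r::'a, s). r * s = c} = (SIGMA r:UNIV. {s. r * s = c})" by auto
  then have "card {(r::'a, s). r * s = c} = (\<Sum>r\<in>UNIV. card {s. r * s = c})" by simp
  also have "\<dots> = card {s. (0::'a) * s = c} + (\<Sum>r\<in>UNIV - {0::'a}. card {s. r * s = c})"
    by (rule sum.remove) simp_all
  also have "card {s. r * s = c} = 1" if "r \<in> UNIV - {0}" for r
  proof -
    have "{s. r * s = c} = {c / r}" using that by (auto simp: field_simps)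
    then show ?thesis by simp
  qed
  then have "(\<Sum>r\<in>UNIV - {0::'a}. card {s. r * s = c}) = CARD('a) - 1"
    by (simp add: card_Diff_subset)
  also have "card {s. (0::'a) * s = c} = (if c = 0 then CARD('a) else 0)" by simp
  finally show ?thesis by simp
qed

lemma card_square_roots_le: "card {x::'a::idom. x\<^sup>2 = c} \<le> 2"
proof (cases "is_square c")
  case True
  then obtain r where "c = r\<^sup>2" by (rule is_nth_powerE)
  then have "{x. x\<^sup>2 = c} = {r, - r}" by (auto simp: power2_eq_iff)
  then show ?thesis by (simp add: card_insert_if)
next
  case False
  then have "{x. x\<^sup>2 = c} = {}" by (auto simp: is_nth_power_def)
  then show ?thesis by simp
qed

lemma card_conic_less:
  fixes r :: "'a::{field,finite}"
  assumes "r \<noteq> 0"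
  shows "card {(i::'a, j). i\<^sup>2 + r\<^sup>2 * j\<^sup>2 = 1} < 2 * CARD('a)"
proof -
  have "card {(i::'a, j). i\<^sup>2 + r\<^sup>2 * j\<^sup>2 = 1} = card (SIGMA j:UNIV. {i. i\<^sup>2 = 1 - r\<^sup>2 * j\<^sup>2})"
    by (rule bij_betw_same_card[where f = prod.swap])
       (rule bij_betw_byWitness[where f' = prod.swap], auto simp: eq_diff_eq)
  also have "\<dots> = (\<Sum>j\<in>UNIV. card {i. i\<^sup>2 = 1 - r\<^sup>2 * j\<^sup>2})" by simp
  also have "\<dots> < (\<Sum>j\<in>(UNIV :: 'a set). 2)"
  proof (rule sum_strict_mono_ex1)
    have "{i. i\<^sup>2 = 1 - r\<^sup>2 * (1 / r)\<^sup>2} = {0}" using assms by (simp add: power_divide)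
    then have "card {i. i\<^sup>2 = 1 - r\<^sup>2 * (1 / r)\<^sup>2} < 2" by simp
    then show "\<exists>j\<in>UNIV. card {i. i\<^sup>2 = 1 - r\<^sup>2 * j\<^sup>2} < 2" by blast
  qed (use card_square_roots_le in auto)
  finally show ?thesis by simp
qed

text \<open>The condition \<open>t \<noteq> 0\<close> singles out the vectors that are not perpendicular to \<open>p\<close>.\<close>

definition quadric_count :: "'a::field \<Rightarrow> 'a \<Rightarrow> nat" where
  "quadric_count \<alpha> \<beta> = card {(i, j, t). \<alpha> * i\<^sup>2 + \<beta> * j\<^sup>2 - t\<^sup>2 = 1 \<and> t \<noteq> 0}"

context
  assumes two: "(2::'a::{field,finite}) \<noteq> 0"
begin

lemma card_nonzero_squares: "CARD('a) = 2 * card {x::'a. x \<noteq> 0 \<and> is_square x} + 1"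
proof -
  have "card (UNIV - {0::'a}) = 2 * card ((\<lambda>x. x\<^sup>2) ` (UNIV - {0::'a}))"
    by (rule card_two_to_one_image[where h = uminus])
       (auto simp: uminus_eq_self_iff[OF two] power2_eq_iff)
  moreover have "(\<lambda>x. x\<^sup>2) ` (UNIV - {0::'a}) = {x. x \<noteq> 0 \<and> is_square x}"
    by (auto elim: is_nth_powerE)
  ultimately show ?thesis
    by (metis Suc_eq_plus1 UNIV_I card_Suc_Diff1 finite_class.finite_UNIV)
qed

lemma card_squares: "2 * card {x::'a. is_square x} = CARD('a) + 1"
proof -
  have "{x::'a. is_square x} = insert 0 {x. x \<noteq> 0 \<and> is_square x}" by auto
  then have "card {x::'a. is_square x} = Suc (card {x::'a. x \<noteq> 0 \<and> is_square x})" by simp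
  with card_nonzero_squares show ?thesis by simp
qed

lemma card_nonsquares: "card {x::'a. \<not> is_square x} = card {x::'a. x \<noteq> 0 \<and> is_square x}"
proof -
  have "card {x::'a. \<not> is_square x} = CARD('a) - card {x::'a. is_square x}"
    by (simp add: card_Diff_subset[symmetric] Compl_eq_Diff_UNIV[symmetric] Collect_neg_eq)
  with card_squares card_nonzero_squares show ?thesis by simp
qed

lemma ex_nonsquare: "\<exists>x::'a. \<not> is_square x"
proof -
  have "{x::'a. x \<noteq> 0 \<and> is_square x} \<noteq> {}"
    using is_nth_power_1 one_neq_zero by blast
  then have "card {x::'a. \<not> is_square x} \<noteq> 0"
    unfolding card_nonsquares by simp
  then show ?thesis by (metis card_0_eq Collect_empty_eq finite)
qed

text \<open>Multiplication by a non-square maps the nonzero squares into the non-squares, hence onto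
  them, because both sets have the same size.\<close>

lemma is_square_mult_nonsquares:
  fixes x y :: 'a
  assumes "\<not> is_square x" "\<not> is_square y"
  shows "is_square (x * y)"
proof -
  have "(*) x ` {z. z \<noteq> 0 \<and> is_square z} = {z. \<not> is_square z}"
  proof (rule card_subset_eq)
    show "(*) x ` {z. z \<noteq> 0 \<and> is_square z} \<subseteq> {z. \<not> is_square z}"
      using assms(1) is_square_mult_cancel_left[of _ x] by (auto simp: mult.commute)
    have "inj_on ((*) x) {z. z \<noteq> 0 \<and> is_square z}"
      using assms(1) by (auto simp: inj_on_def)
    then show "card ((*) x ` {z. z \<noteq> 0 \<and> is_square z}) = card {z::'a. \<not> is_square z}"
      unfolding card_nonsquares by (rule card_image)
  qed simp
  then obtain z where "is_square z" "y = x * z" using assms(2) by blast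
  then have "x * y = x\<^sup>2 * z" by (simp add: power2_eq_square)
  then show ?thesis using is_nth_power_mult[OF is_nth_power_nth_power \<open>is_square z\<close>] by simp
qed

lemma is_square_mult_iff:
  fixes x y :: 'a
  assumes "x \<noteq> 0" "y \<noteq> 0"
  shows "is_square (x * y) \<longleftrightarrow> (is_square x \<longleftrightarrow> is_square y)"
  using assms is_square_mult_cancel_left[of x y] is_square_mult_cancel_left[of y x]
    is_square_mult_nonsquares[of x y]
  by (auto simp: mult.commute)

lemma is_square_minus_one_iff: "is_square (- 1 :: 'a) \<longleftrightarrow> CARD('a) mod 4 = 1"
proof -
  let ?S = "{x::'a. x \<noteq> 0 \<and> is_square x}"
  have "even (card ?S) \<longleftrightarrow> even (card {x \<in> ?S. inverse x = x})"
  proof (rule even_card_iff_even_card_fixed_points)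
    show "inverse x \<in> ?S \<and> inverse (inverse x) = x" if "x \<in> ?S" for x
      using that by (auto elim!: is_nth_powerE simp flip: power_inverse)
  qed simp
  moreover have "{x \<in> ?S. inverse x = x} = (if is_square (-1::'a) then {1, -1} else {1})"
  proof -
    have "inverse x = x \<longleftrightarrow> x = 1 \<or> x = -1" if "x \<noteq> 0" for x :: 'a
      using that power2_eq_1_iff[of x]
      by (auto simp: power2_eq_square dest: right_inverse[of x])
    then show ?thesis by auto
  qed
  moreover have "(1::'a) \<noteq> -1" using uminus_eq_self_iff[OF two, of 1] by simp
  ultimately have "even (card ?S) \<longleftrightarrow> is_square (-1::'a)" by simp
  moreover have "CARD('a) mod 4 = 1 \<longleftrightarrow> even (card ?S)"
    unfolding card_nonzero_squares by presburger
  ultimately show ?thesis by blast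
qed

lemma ex_binary_form_value:
  fixes \<alpha> \<beta> c :: 'a
  assumes "\<alpha> \<noteq> 0" "\<beta> \<noteq> 0"
  obtains i j where "\<alpha> * i\<^sup>2 + \<beta> * j\<^sup>2 = c"
proof -
  let ?S = "{x::'a. is_square x}"
  let ?X = "(\<lambda>x. \<alpha> * x) ` ?S" and ?Y = "(\<lambda>x. c - \<beta> * x) ` ?S"
  have "card ?X = card ?S" "card ?Y = card ?S"
    using assms by (auto intro!: card_image inj_onI)
  then have "card ?X + card ?Y > CARD('a)" using card_squares by simp
  moreover have "card (?X \<union> ?Y) \<le> CARD('a)" by (rule card_mono) auto
  moreover have "card (?X \<union> ?Y) = card ?X + card ?Y" if "?X \<inter> ?Y = {}"
    using that by (intro card_Un_disjoint) auto
  ultimately have "?X \<inter> ?Y \<noteq> {}" by fastforce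
  then obtain i j where "\<alpha> * i\<^sup>2 = c - \<beta> * j\<^sup>2" by (auto elim!: is_nth_powerE)
  then show thesis by (intro that[of i j]) simp
qed

text \<open>A form that represents \<open>1\<close> is equivalent to \<open>x\<^sup>2 + \<Delta> w\<^sup>2\<close>, where \<open>\<Delta>\<close> is its discriminant.\<close>

lemma quadric_count_eq_discriminant:
  fixes \<alpha> \<beta> :: 'a
  assumes "\<alpha> \<noteq> 0" "\<beta> \<noteq> 0"
  shows "quadric_count \<alpha> \<beta> = quadric_count 1 (\<alpha> * \<beta>)"
proof -
  obtain k l where kl: "\<alpha> * k\<^sup>2 + \<beta> * l\<^sup>2 = 1"
    using ex_binary_form_value[OF assms] .
  let ?f = "\<lambda>(x, w, t). (k * x - \<beta> * l * w, l * x + \<alpha> * k * w, t)"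
  let ?g = "\<lambda>(i, j, t). (\<alpha> * k * i + \<beta> * l * j, k * j - l * i, t)"
  have f_form: "\<alpha> * (k * x - \<beta> * l * w)\<^sup>2 + \<beta> * (l * x + \<alpha> * k * w)\<^sup>2 = x\<^sup>2 + \<alpha> * \<beta> * w\<^sup>2" for x w
  proof -
    have "\<alpha> * (k * x - \<beta> * l * w)\<^sup>2 + \<beta> * (l * x + \<alpha> * k * w)\<^sup>2
      = (\<alpha> * k\<^sup>2 + \<beta> * l\<^sup>2) * (x\<^sup>2 + \<alpha> * \<beta> * w\<^sup>2)" by algebra
    then show ?thesis using kl by simp
  qed
  have g_form: "(\<alpha> * k * i + \<beta> * l * j)\<^sup>2 + \<alpha> * \<beta> * (k * j - l * i)\<^sup>2 = \<alpha> * i\<^sup>2 + \<beta> * j\<^sup>2" for i j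
  proof -
    have "(\<alpha> * k * i + \<beta> * l * j)\<^sup>2 + \<alpha> * \<beta> * (k * j - l * i)\<^sup>2
      = (\<alpha> * k\<^sup>2 + \<beta> * l\<^sup>2) * (\<alpha> * i\<^sup>2 + \<beta> * j\<^sup>2)" by algebra
    then show ?thesis using kl by simp
  qed
  have g_f: "\<alpha> * k * (k * x - \<beta> * l * w) + \<beta> * l * (l * x + \<alpha> * k * w) = x"
    "k * (l * x + \<alpha> * k * w) - l * (k * x - \<beta> * l * w) = w" for x w
    using kl by algebra+
  have f_g: "k * (\<alpha> * k * i + \<beta> * l * j) - \<beta> * l * (k * j - l * i) = i"
    "l * (\<alpha> * k * i + \<beta> * l * j) + \<alpha> * k * (k * j - l * i) = j" for i j
    using kl by algebra+
  have "bij_betw ?f {(x, w, t). 1 * x\<^sup>2 + \<alpha> * \<beta> * w\<^sup>2 - t\<^sup>2 = 1 \<and> t \<noteq> 0}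
     {(i, j, t). \<alpha> * i\<^sup>2 + \<beta> * j\<^sup>2 - t\<^sup>2 = 1 \<and> t \<noteq> 0}"
    by (rule bij_betw_byWitness[where f' = ?g]) (auto simp: g_f f_g f_form g_form)
  from bij_betw_same_card[OF this] show ?thesis
    unfolding quadric_count_def by (rule sym)
qed

lemma card_square_diff_eq:
  "card {(x::'a, t). x\<^sup>2 - t\<^sup>2 = c} = CARD('a) - 1 + (if c = 0 then CARD('a) else 0)"
proof -
  have halves: "(x + t + (x - t)) / 2 = x" "(x + t - (x - t)) / 2 = t"
    "(x + t) / 2 + (x - t) / 2 = x" "(x + t) / 2 - (x - t) / 2 = t" for x t :: 'a
    using two by (simp_all flip: mult_2 add_divide_distrib diff_divide_distrib)
  have factor: "x\<^sup>2 - t\<^sup>2 = (x + t) * (x - t)" for x t :: 'a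
    by (simp add: power2_eq_square square_diff_square_factored)
  have "bij_betw (\<lambda>(x, t). (x + t, x - t)) {(x::'a, t). x\<^sup>2 - t\<^sup>2 = c} {(r, s). r * s = c}"
    by (rule bij_betw_byWitness[where f' = "\<lambda>(r, s). ((r + s) / 2, (r - s) / 2)"])
       (auto simp: factor halves two)
  from bij_betw_same_card[OF this] show ?thesis by (simp only: card_prod_eq)
qed

lemma quadric_count_plus_conic:
  "quadric_count 1 \<Delta> + card {(i::'a, j). i\<^sup>2 + \<Delta> * j\<^sup>2 = 1}
    = CARD('a) * (CARD('a) - 1) + CARD('a) * card {j. \<Delta> * j\<^sup>2 = 1}"
proof -
  let ?Q = "{(i::'a, j, t). 1 * i\<^sup>2 + \<Delta> * j\<^sup>2 - t\<^sup>2 = 1}"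
  have "card {(i::'a, j). i\<^sup>2 + \<Delta> * j\<^sup>2 = 1} = card {(i, j, t). (i, j, t) \<in> ?Q \<and> t = 0}"
    by (rule bij_betw_same_card[where f = "\<lambda>(i, j). (i, j, 0)"])
       (rule bij_betw_byWitness[where f' = "\<lambda>(i, j, t). (i, j)"], auto)
  then have "quadric_count 1 \<Delta> + card {(i::'a, j). i\<^sup>2 + \<Delta> * j\<^sup>2 = 1} = card ?Q"
    unfolding quadric_count_def
    by (simp only:, subst card_Un_disjoint[symmetric]) (auto intro: arg_cong[where f = card])
  also have "\<dots> = card (SIGMA j:UNIV. {(x::'a, t). x\<^sup>2 - t\<^sup>2 = 1 - \<Delta> * j\<^sup>2})"
    by (rule bij_betw_same_card[where f = "\<lambda>(i, j, t). (j, i, t)"])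
       (rule bij_betw_byWitness[where f' = "\<lambda>(j, i, t). (i, j, t)"], auto simp: eq_diff_eq diff_add_eq)
  also have "\<dots> = (\<Sum>j\<in>UNIV. CARD('a) - 1 + (if \<Delta> * j\<^sup>2 = 1 then CARD('a) else 0))"
    by (simp add: card_square_diff_eq eq_commute[of 1])
  also have "\<dots> = CARD('a) * (CARD('a) - 1) + CARD('a) * card {j. \<Delta> * j\<^sup>2 = 1}"
    by (subst sum.distrib) (simp add: sum.If_cases)
  finally show ?thesis .
qed

lemma quadric_count_nonsquare_less_square:
  fixes r \<Delta> :: 'a
  assumes "\<not> is_square \<Delta>" "r \<noteq> 0"
  shows "quadric_count 1 \<Delta> < quadric_count 1 (r\<^sup>2)"
proof -
  have "\<Delta> = (1 / j)\<^sup>2" if "\<Delta> * j\<^sup>2 = 1" for j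
    using that by (cases "j = 0") (simp_all add: field_simps)
  with assms(1) have "{j. \<Delta> * j\<^sup>2 = 1} = {}" by (auto simp: is_nth_power_def)
  then have "quadric_count 1 \<Delta> \<le> CARD('a) * (CARD('a) - 1)"
    using quadric_count_plus_conic[of \<Delta>] by simp
  also have "\<dots> < quadric_count 1 (r\<^sup>2)"
  proof -
    have "r\<^sup>2 * j\<^sup>2 = 1 \<longleftrightarrow> j = 1 / r \<or> j = - (1 / r)" for j
      using assms(2) by (simp add: power2_eq_1_iff field_simps flip: power_mult_distrib)
    then have "{j. r\<^sup>2 * j\<^sup>2 = 1} = {1 / r, - (1 / r)}" by blast
    moreover have "- (1 / r) \<noteq> 1 / r"
      using assms(2) unfolding uminus_eq_self_iff[OF two] by simp
    ultimately have "card {j. r\<^sup>2 * j\<^sup>2 = 1} = 2" by auto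
    then show ?thesis
      using quadric_count_plus_conic[of "r\<^sup>2"] card_conic_less[OF assms(2)] by simp
  qed
  finally show ?thesis .
qed

lemma quadric_count_mult_nonsquare_neq:
  fixes \<alpha> \<beta> \<gamma> :: 'a
  assumes "\<alpha> \<noteq> 0" "\<beta> \<noteq> 0" and \<gamma>: "\<not> is_square \<gamma>"
  shows "quadric_count (\<alpha> * \<gamma>) \<beta> \<noteq> quadric_count \<alpha> \<beta>"
proof -
  have nz: "\<gamma> \<noteq> 0" "\<alpha> * \<beta> \<noteq> 0" using assms by auto
  have neq: "quadric_count 1 x \<noteq> quadric_count 1 y"
    if "\<not> is_square x" "is_square y" "y \<noteq> 0" for x y :: 'a
    using that quadric_count_nonsquare_less_square[of x]
    by (metis is_nth_powerE less_irrefl zero_power2)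
  have "is_square (\<gamma> * (\<alpha> * \<beta>)) \<longleftrightarrow> \<not> is_square (\<alpha> * \<beta>)"
    using is_square_mult_iff[OF nz] \<gamma> by simp
  then have "quadric_count 1 (\<gamma> * (\<alpha> * \<beta>)) \<noteq> quadric_count 1 (\<alpha> * \<beta>)"
    using neq[of "\<gamma> * (\<alpha> * \<beta>)" "\<alpha> * \<beta>"] neq[of "\<alpha> * \<beta>" "\<gamma> * (\<alpha> * \<beta>)"] nz by fastforce
  then show ?thesis
    using quadric_count_eq_discriminant[of "\<alpha> * \<gamma>" \<beta>]
      quadric_count_eq_discriminant[of \<alpha> \<beta>] assms nz
    by (simp add: mult_ac)
qed

end


subsection \<open>Quadratic spaces\<close>

locale quadratic_space =
  fixes \<sigma> :: "'a::field ^ 'n \<Rightarrow> 'a"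
  assumes form: "quadratic_form \<sigma>"
    and nondeg: "nondegenerate \<sigma>"
    and two: "(2::'a) \<noteq> 0"
begin

definition bil :: "'a ^ 'n \<Rightarrow> 'a ^ 'n \<Rightarrow> 'a" where
  "bil u v = polar \<sigma> u v / 2"

lemma bil_add_left [simp]: "bil (u + v) w = bil u w + bil v w"
  using form unfolding quadratic_form_def bil_def
  by (auto simp: Vector_Spaces.linear_iff add_divide_distrib)

lemma bil_scale_left [simp]: "bil (c *s u) w = c * bil u w"
  using form unfolding quadratic_form_def bil_def
  by (auto simp: Vector_Spaces.linear_iff)

lemma bil_commute: "bil u v = bil v u"
  by (simp add: bil_def polar_def add.commute)

lemma bil_add_right [simp]: "bil w (u + v) = bil w u + bil w v"
  by (simp add: bil_commute[of w])

lemma bil_scale_right [simp]: "bil w (c *s u) = c * bil w u"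
  by (simp add: bil_commute[of w])

lemma bil_zero_left [simp]: "bil 0 w = 0"
  using bil_scale_left[of 0 0 w] by simp

lemma bil_minus_left [simp]: "bil (- u) w = - bil u w"
  using bil_scale_left[of "-1" u w] by simp

lemma bil_minus_right [simp]: "bil w (- u) = - bil w u"
  by (simp add: bil_commute[of w])

lemma bil_diff_left [simp]: "bil (u - v) w = bil u w - bil v w"
  using bil_add_left[of u "- v" w] by simp

lemma bil_diff_right [simp]: "bil w (u - v) = bil w u - bil w v"
  by (simp add: bil_commute[of w])

lemma bil_self: "bil v v = \<sigma> v"
proof -
  have "\<sigma> (2 *s v) = 2\<^sup>2 * \<sigma> v"
    using form unfolding quadratic_form_def by blast
  moreover have "v + v = 2 *s v" by (simp add: vec_eq_iff)
  ultimately have "polar \<sigma> v v = 2 * \<sigma> v" by (simp add: polar_def)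
  then show ?thesis using two by (simp add: bil_def)
qed

lemma mem_perp_iff: "v \<in> perp \<sigma> S \<longleftrightarrow> (\<forall>s\<in>S. bil v s = 0)"
  using two by (simp add: perp_def bil_def)

lemma subspace_perp: "vec.subspace (perp \<sigma> S)"
  by (rule vec.subspaceI) (auto simp: mem_perp_iff)

lemma perp_span: "perp \<sigma> (vec.span S) = perp \<sigma> S"
proof
  show "perp \<sigma> (vec.span S) \<subseteq> perp \<sigma> S"
    using vec.span_superset unfolding perp_def by blast
  show "perp \<sigma> S \<subseteq> perp \<sigma> (vec.span S)"
  proof
    fix v assume "v \<in> perp \<sigma> S"
    then have "S \<subseteq> perp \<sigma> {v}" by (auto simp: mem_perp_iff bil_commute)
    then have "vec.span S \<subseteq> perp \<sigma> {v}" by (rule vec.span_minimal[OF _ subspace_perp])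
    then show "v \<in> perp \<sigma> (vec.span S)" by (auto simp: mem_perp_iff bil_commute)
  qed
qed

lemma perp_UNIV: "perp \<sigma> UNIV = {0}"
  using nondeg by (simp add: nondegenerate_def)

definition nondegenerate_on :: "('a ^ 'n) set \<Rightarrow> bool" where
  "nondegenerate_on S \<longleftrightarrow> vec.subspace S \<and> S \<inter> perp \<sigma> S \<subseteq> {0}"

lemma nondegenerate_on_UNIV: "nondegenerate_on UNIV"
  by (simp add: nondegenerate_on_def perp_UNIV)

lemma nondegenerate_on_Int_perp:
  assumes S: "nondegenerate_on S" and v: "v \<in> S" "bil v v \<noteq> 0"
  shows "nondegenerate_on (S \<inter> perp \<sigma> {v})" and "vec.dim S = Suc (vec.dim (S \<inter> perp \<sigma> {v}))"
proof -
  let ?T = "S \<inter> perp \<sigma> {v}"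
  have sub: "vec.subspace S" using S by (simp add: nondegenerate_on_def)
  have sub_T: "vec.subspace ?T" using vec.subspace_inter[OF sub subspace_perp] .
  have projection: "x - (bil x v / bil v v) *s v \<in> ?T" if "x \<in> S" for x
    using that v sub by (auto simp: mem_perp_iff vec.subspace_diff vec.subspace_scale)
  show "nondegenerate_on ?T"
    unfolding nondegenerate_on_def
  proof (intro conjI subsetI)
    fix x assume x: "x \<in> ?T \<inter> perp \<sigma> ?T"
    have "bil x y = 0" if "y \<in> S" for y
    proof -
      have "\<forall>t\<in>?T. bil x t = 0" "bil x v = 0" using x by (simp_all add: mem_perp_iff)
      with projection[OF that] have "bil x (y - (bil y v / bil v v) *s v) = 0" by blast
      with \<open>bil x v = 0\<close> show ?thesis by simp
    qed
    then show "x \<in> {0}" using S x by (auto simp: nondegenerate_on_def mem_perp_iff)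
  qed (fact sub_T)
  have "v \<notin> vec.span ?T"
    using v(2) sub_T by (simp add: vec.span_eq_iff[THEN iffD2] mem_perp_iff)
  then have "vec.dim (insert v ?T) = Suc (vec.dim ?T)" by (simp add: vec.dim_insert)
  moreover have "vec.span (insert v ?T) = S"
  proof
    show "vec.span (insert v ?T) \<subseteq> S"
      by (rule vec.span_minimal) (use v sub in auto)
    show "S \<subseteq> vec.span (insert v ?T)"
      using projection vec.span_base unfolding vec.span_insert by blast
  qed
  ultimately show "vec.dim S = Suc (vec.dim ?T)" by (metis vec.dim_span)
qed

lemma nondegenerate_on_ex_nonsingular:
  assumes "nondegenerate_on S" "0 < vec.dim S"
  obtains v where "v \<in> S" "bil v v \<noteq> 0"
proof -
  have "\<exists>v\<in>S. bil v v \<noteq> 0"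
  proof (rule ccontr)
    assume "\<not> ?thesis"
    then have singular: "bil v v = 0" if "v \<in> S" for v using that by blast
    have "bil x y = 0" if "x \<in> S" "y \<in> S" for x y
    proof -
      have "x + y \<in> S"
        using that assms(1) by (simp add: nondegenerate_on_def vec.subspace_add)
      from singular[OF this] singular that have "2 * bil x y = 0"
        by (simp add: bil_commute[of y x])
      then show ?thesis using two by simp
    qed
    then have "S \<subseteq> {0}" using assms(1) by (auto simp: nondegenerate_on_def mem_perp_iff)
    then have "vec.dim S = 0" by simp
    with assms(2) show False by linarith
  qed
  with that show thesis by blast
qed


subsection \<open>Orthogonal frames and isometries\<close>

definition orthogonal_frame :: "('a ^ 'n) list \<Rightarrow> bool" where
  "orthogonal_frame us \<longleftrightarrow> distinct us \<and>
     (\<forall>u\<in>set us. bil u u \<noteq> 0) \<and> pairwise (\<lambda>u v. bil u v = 0) (set us)"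

lemma orthogonal_frame_Nil [simp]: "orthogonal_frame []"
  by (simp add: orthogonal_frame_def)

lemma orthogonal_frame_Cons [simp]:
  "orthogonal_frame (u # us) \<longleftrightarrow> bil u u \<noteq> 0 \<and> u \<in> perp \<sigma> (set us) \<and> orthogonal_frame us"
proof -
  have "pairwise (\<lambda>u v. bil u v = 0) (insert u (set us)) \<longleftrightarrow>
      u \<in> perp \<sigma> (set us - {u}) \<and> pairwise (\<lambda>u v. bil u v = 0) (set us)"
    by (simp add: pairwise_insert mem_perp_iff bil_commute[of _ u]) blast
  moreover have "u \<notin> set us" if "u \<in> perp \<sigma> (set us)" "bil u u \<noteq> 0"
    using that by (auto simp: mem_perp_iff)
  ultimately show ?thesis by (auto simp: orthogonal_frame_def)
qed

lemma orthogonal_frame_bil: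
  "orthogonal_frame us \<Longrightarrow> u \<in> set us \<Longrightarrow> v \<in> set us \<Longrightarrow> u \<noteq> v \<Longrightarrow> bil u v = 0"
  by (simp add: orthogonal_frame_def pairwise_def)

lemma orthogonal_frame_append:
  "orthogonal_frame (us @ vs) \<longleftrightarrow>
     orthogonal_frame us \<and> orthogonal_frame vs \<and> (\<forall>u\<in>set us. u \<in> perp \<sigma> (set vs))"
  by (induction us) (auto simp: mem_perp_iff)

lemma orthogonal_frame_mset_cong:
  "mset us = mset vs \<Longrightarrow> orthogonal_frame us \<longleftrightarrow> orthogonal_frame vs"
  using mset_eq_setD[of us vs] mset_eq_imp_distinct_iff[of us vs]
  by (simp add: orthogonal_frame_def)

lemma perp_orthogonal_frame:
  assumes "orthogonal_frame us"
  shows "nondegenerate_on (perp \<sigma> (set us)) \<and> vec.dim (perp \<sigma> (set us)) + length us = CARD('n)"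
  using assms
proof (induction us)
  case Nil
  have "perp \<sigma> {} = UNIV" by (auto simp: perp_def)
  then show ?case
    using nondegenerate_on_UNIV vec_dim_card[where 'a = 'a and 'n = 'n] by simp
next
  case (Cons u us)
  have "perp \<sigma> (set (u # us)) = perp \<sigma> (set us) \<inter> perp \<sigma> {u}"
    by (auto simp: mem_perp_iff)
  with Cons show ?case
    using nondegenerate_on_Int_perp[of "perp \<sigma> (set us)" u] by simp
qed

lemma orthogonal_frame_extend:
  assumes "orthogonal_frame us" "length us < CARD('n)"
  obtains v where "orthogonal_frame (v # us)"
proof -
  have "nondegenerate_on (perp \<sigma> (set us))" "0 < vec.dim (perp \<sigma> (set us))"
    using perp_orthogonal_frame[OF assms(1)] assms(2) by linarith+
  then obtain v where "v \<in> perp \<sigma> (set us)" "bil v v \<noteq> 0"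
    by (rule nondegenerate_on_ex_nonsingular)
  with assms(1) that show thesis by simp
qed

lemma orthogonal_frame_complete:
  assumes "orthogonal_frame us" "length us = CARD('n)" "x \<in> perp \<sigma> (set us)"
  shows "x = 0"
proof -
  have "vec.dim (perp \<sigma> (set us)) = 0"
    using perp_orthogonal_frame[OF assms(1)] assms(2) by simp
  with assms(3) show ?thesis by auto
qed

definition isometry :: "('a ^ 'n \<Rightarrow> 'a ^ 'n) \<Rightarrow> bool" where
  "isometry g \<longleftrightarrow> Vector_Spaces.linear (*s) (*s) g \<and> (\<forall>u v. bil (g u) (g v) = bil u v)"

lemma bil_isometry: "isometry g \<Longrightarrow> bil (g u) (g v) = bil u v"
  by (simp add: isometry_def)

lemma isometry_comp: "isometry g \<Longrightarrow> isometry h \<Longrightarrow> isometry (h \<circ> g)"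
  by (auto simp: isometry_def intro: Vector_Spaces.linear_compose)

lemma inj_isometry:
  assumes "isometry g"
  shows "inj g"
proof (rule injI)
  fix x y assume "g x = g y"
  then have "bil (x - y) w = 0" for w
    using bil_isometry[OF assms, of x w] bil_isometry[OF assms, of y w] by simp
  then have "x - y \<in> perp \<sigma> UNIV" by (simp add: mem_perp_iff)
  then show "x = y" by (simp add: perp_UNIV)
qed

lemma orthogonal_frame_map_isometry:
  "isometry g \<Longrightarrow> orthogonal_frame (map g us) \<longleftrightarrow> orthogonal_frame us"
  by (induction us) (auto simp: mem_perp_iff bil_isometry)

definition reflection :: "'a ^ 'n \<Rightarrow> 'a ^ 'n \<Rightarrow> 'a ^ 'n" where
  "reflection r u = u - (2 * bil u r / bil r r) *s r"

lemma isometry_reflection: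
  assumes "bil r r \<noteq> 0"
  shows "isometry (reflection r)"
  unfolding isometry_def
proof (intro conjI allI)
  show "Vector_Spaces.linear (*s) (*s) (reflection r)"
    by (simp add: Vector_Spaces.linear_iff vec.vector_space_axioms reflection_def
        vec_eq_iff algebra_simps add_divide_distrib)
  show "bil (reflection r u) (reflection r v) = bil u v" for u v
    using assms by (simp add: reflection_def bil_commute[of r v] field_simps)
qed

lemma reflection_fixes: "bil u r = 0 \<Longrightarrow> reflection r u = u"
  by (simp add: reflection_def)

lemma reflection_uminus: "bil r r \<noteq> 0 \<Longrightarrow> reflection r (- r) = r"
  by (simp add: reflection_def vec_eq_iff)

lemma reflection_diff:
  assumes "bil x x = bil y y" "bil (x - y) (x - y) \<noteq> 0"
  shows "reflection (x - y) x = y"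
proof -
  have "2 * bil x (x - y) = bil (x - y) (x - y)"
    using assms(1) by (simp add: bil_commute[of y x])
  then show ?thesis
    using assms(2) by (simp add: reflection_def del: bil_diff_left bil_diff_right)
qed

lemma isometry_moving:
  assumes eq: "bil x x = bil y y" and nonsingular: "bil y y \<noteq> 0"
  obtains g where "isometry g" "g x = y" "\<And>t. t \<in> perp \<sigma> {x, y} \<Longrightarrow> g t = t"
proof (cases "bil (x - y) (x - y) = 0")
  case False
  show thesis
    using that[of "reflection (x - y)"] isometry_reflection[OF False] reflection_diff[OF eq False]
    by (simp add: mem_perp_iff reflection_fixes)
next
  case True
  have "bil (x - y) (x - y) + bil (x - - y) (x - - y) = 2 * 2 * bil y y"
    using eq by (simp add: bil_commute[of y x])
  then have sum: "bil (x - - y) (x - - y) \<noteq> 0"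
    using True nonsingular two by (metis add_0 mult_eq_0_iff)
  show thesis
  proof (rule that[of "reflection y \<circ> reflection (x - - y)"])
    show "isometry (reflection y \<circ> reflection (x - - y))"
      by (intro isometry_comp isometry_reflection sum nonsingular)
    have "reflection (x - - y) x = - y"
      using eq sum by (intro reflection_diff) simp_all
    then show "(reflection y \<circ> reflection (x - - y)) x = y"
      by (simp add: reflection_uminus[OF nonsingular])
  qed (simp add: mem_perp_iff reflection_fixes)
qed

lemma isometry_of_orthogonal_frames:
  assumes "orthogonal_frame us" "orthogonal_frame vs"
    "map (\<lambda>u. bil u u) us = map (\<lambda>v. bil v v) vs"
  obtains g where "isometry g" "map g us = vs"
proof -
  have "length us = length vs" using assms(3) by (rule map_eq_imp_length_eq)
  from this assms have "\<exists>g. isometry g \<and> map g us = vs"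
  proof (induction us vs rule: list_induct2)
    case Nil
    have "isometry id" by (simp add: isometry_def vec.linear_id)
    then show ?case by auto
  next
    case (Cons u us v vs)
    then obtain g where g: "isometry g" "map g us = vs" by auto
    have "bil (g u) (g u) = bil v v" "bil v v \<noteq> 0"
      using Cons.prems by (simp_all add: bil_isometry[OF g(1)])
    then obtain h where h: "isometry h" "h (g u) = v" "\<And>t. t \<in> perp \<sigma> {g u, v} \<Longrightarrow> h t = t"
      using isometry_moving by metis
    have "h (g t) = g t" if "t \<in> set us" for t
    proof (rule h(3))
      have "g t \<in> set vs" using that g(2) by auto
      then show "g t \<in> perp \<sigma> {g u, v}"
        using that Cons.prems bil_commute by (auto simp: mem_perp_iff bil_isometry[OF g(1)])
    qed
    then have "map (h \<circ> g) (u # us) = v # vs" using g(2) h(2) by auto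
    then show ?case using isometry_comp[OF g(1) h(1)] by (intro exI[of _ "h \<circ> g"] conjI)
  qed
  with that show thesis by blast
qed

definition level :: "'a \<Rightarrow> ('a ^ 'n) set" where
  "level e = {v. bil v v = e}"

end

locale finite_quadratic_space = quadratic_space \<sigma>
  for \<sigma> :: "'a::{field,finite} ^ 'n \<Rightarrow> 'a"
begin

lemma orthogonal_frame_extend_value:
  assumes us: "orthogonal_frame us" "length us + 2 \<le> CARD('n)" and c: "c \<noteq> 0"
  obtains v where "orthogonal_frame (v # us)" "bil v v = c"
proof -
  obtain x where x: "orthogonal_frame (x # us)"
    using orthogonal_frame_extend[OF us(1)] us(2) by auto
  then obtain y where y: "orthogonal_frame (y # x # us)"
    using orthogonal_frame_extend[of "x # us"] us(2) by auto
  have nonsingular: "bil x x \<noteq> 0" "bil y y \<noteq> 0" using x y by simp_all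
  have xy: "bil y x = 0" "bil x y = 0" using y bil_commute[of x y]
    by (simp_all add: mem_perp_iff)
  obtain i j where ij: "bil x x * i\<^sup>2 + bil y y * j\<^sup>2 = c"
    using ex_binary_form_value[OF two nonsingular] .
  have "bil (i *s x + j *s y) (i *s x + j *s y) = c"
    using ij xy by (simp add: power2_eq_square mult_ac)
  then show thesis
    using that[of "i *s x + j *s y"] us(1) c x y by (simp add: mem_perp_iff)
qed

lemma orthogonal_frame_extend_values:
  assumes "orthogonal_frame us" "length cs + length us < CARD('n)" "0 \<notin> set cs"
  obtains vs where "orthogonal_frame (vs @ us)" "map (\<lambda>v. bil v v) vs = cs"
proof -
  have "\<exists>vs. orthogonal_frame (vs @ us) \<and> map (\<lambda>v. bil v v) vs = cs"
    using assms(2,3)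
  proof (induction cs)
    case Nil
    then show ?case using assms(1) by simp
  next
    case (Cons c cs)
    then obtain vs where vs: "orthogonal_frame (vs @ us)" "map (\<lambda>v. bil v v) vs = cs" by auto
    have "length (vs @ us) + 2 \<le> CARD('n)" using Cons.prems(1) vs(2) by auto
    with Cons.prems(2) obtain v where "orthogonal_frame (v # vs @ us)" "bil v v = c"
      using orthogonal_frame_extend_value[OF vs(1)] by auto
    then show ?case using vs(2) by (intro exI[of _ "v # vs"]) auto
  qed
  with that show thesis by blast
qed

lemma card_level_perp_frame_eq:
  assumes "orthogonal_frame us" "orthogonal_frame vs"
    "map (\<lambda>u. bil u u) us = map (\<lambda>v. bil v v) vs"
  shows "card (level e \<inter> perp \<sigma> (set us)) = card (level e \<inter> perp \<sigma> (set vs))"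
proof (rule antisym)
  have "card (level e \<inter> perp \<sigma> (set us)) \<le> card (level e \<inter> perp \<sigma> (set vs))"
    if frames: "orthogonal_frame us" "orthogonal_frame vs"
      "map (\<lambda>u. bil u u) us = map (\<lambda>v. bil v v) vs" for us vs
  proof -
    obtain g where g: "isometry g" "map g us = vs"
      using isometry_of_orthogonal_frames[OF frames] .
    have "g ` (level e \<inter> perp \<sigma> (set us)) \<subseteq> level e \<inter> perp \<sigma> (set vs)"
      unfolding g(2)[symmetric] by (auto simp: level_def mem_perp_iff bil_isometry[OF g(1)])
    then show ?thesis
      using inj_isometry[OF g(1)] by (intro card_inj_on_le) (auto intro: inj_on_subset)
  qed
  from this[OF assms] this[OF assms(2,1) assms(3)[symmetric]]
  show "card (level e \<inter> perp \<sigma> (set us)) \<le> card (level e \<inter> perp \<sigma> (set vs))"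
    "card (level e \<inter> perp \<sigma> (set vs)) \<le> card (level e \<inter> perp \<sigma> (set us))" .
qed

end


subsection \<open>Points\<close>

definition pt :: "'a::field ^ 'n \<Rightarrow> ('a ^ 'n) set" where
  "pt v = vec.span {v}"

lemma mem_pt: "v \<in> pt v"
  by (simp add: pt_def vec.span_base)

lemma subspace_pt: "vec.subspace (pt v)"
  by (simp add: pt_def)

lemma dim_pt: "v \<noteq> 0 \<Longrightarrow> vec.dim (pt v) = 1"
  by (simp add: pt_def vec.dim_insert)

lemma pt_subset_iff:
  assumes "vec.subspace S"
  shows "pt v \<subseteq> S \<longleftrightarrow> v \<in> S"
  using mem_pt vec.span_minimal[OF _ assms, of "{v}"] by (auto simp: pt_def)

lemma pt_eqD: "pt u = pt v \<Longrightarrow> \<exists>c. u = c *s v"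
  using mem_pt[of u] by (auto simp: pt_def vec.span_singleton)

lemma pt_scale:
  assumes "c \<noteq> 0"
  shows "pt (c *s v) = pt v"
proof (rule antisym)
  have "c *s v \<in> pt v" using vec.subspace_scale[OF subspace_pt mem_pt] .
  then show "pt (c *s v) \<subseteq> pt v" by (simp add: pt_subset_iff[OF subspace_pt])
  have "(1 / c) *s (c *s v) \<in> pt (c *s v)" using vec.subspace_scale[OF subspace_pt mem_pt] .
  then show "pt v \<subseteq> pt (c *s v)" using assms by (simp add: pt_subset_iff[OF subspace_pt])
qed

lemma points_eq_image_pt: "points = pt ` (- {0})"
proof (intro equalityI subsetI)
  fix x :: "('a ^ 'n) set" assume "x \<in> points"
  then have x: "vec.subspace x" "vec.dim x = 1" by (auto simp: points_def)
  then obtain v where v: "v \<in> x" "v \<noteq> 0" using vec.dim_eq_0[of x] by auto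
  have "pt v = x"
    by (rule vec.subspace_dim_equal) (use x v in \<open>auto simp: dim_pt subspace_pt pt_subset_iff\<close>)
  then show "x \<in> pt ` (- {0})" using v by auto
qed (auto simp: points_def subspace_pt dim_pt)

lemma span_insert_hyperplane:
  assumes "vec.subspace p" "vec.subspace L" "p \<subseteq> L" "vec.dim L = Suc (vec.dim p)"
    and v: "v \<in> L" "v \<notin> p"
  shows "vec.span (insert v p) = L"
proof (rule vec.subspace_dim_equal)
  show "vec.span (insert v p) \<subseteq> L" using assms by (intro vec.span_minimal) auto
  have "v \<notin> vec.span p" using assms(1) v(2) by (simp add: vec.span_eq_iff[THEN iffD2])
  then show "vec.dim L \<le> vec.dim (vec.span (insert v p))"
    using assms(4) by (simp add: vec.dim_insert)
qed (use assms in auto)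

definition coset_points :: "('a::field ^ 'n) set \<Rightarrow> 'a ^ 'n \<Rightarrow> ('a ^ 'n) set set" where
  "coset_points p v = (\<lambda>w. pt (v + w)) ` p"

abbreviation points_diff :: "('a::field ^ 'n) set \<Rightarrow> ('a ^ 'n) set \<Rightarrow> ('a ^ 'n) set set" where
  "points_diff L L' \<equiv> {x \<in> points. x \<subseteq> L \<and> \<not> x \<subseteq> L'}"

lemma points_diff_hyperplane:
  assumes L: "vec.subspace L" "vec.subspace L'" "vec.dim L = Suc (vec.dim (L \<inter> L'))"
    and v: "v \<in> L" "v \<notin> L'"
  shows "points_diff L L' = coset_points (L \<inter> L') v"
proof -
  let ?p = "L \<inter> L'"
  have sub: "vec.subspace ?p" using vec.subspace_inter[OF L(1,2)] .
  have "points_diff L L' = pt ` {u. u \<noteq> 0 \<and> pt u \<subseteq> L \<and> \<not> pt u \<subseteq> L'}"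
    unfolding points_eq_image_pt by blast
  also have "{u. u \<noteq> 0 \<and> pt u \<subseteq> L \<and> \<not> pt u \<subseteq> L'} = L - L'"
    unfolding pt_subset_iff[OF L(1)] pt_subset_iff[OF L(2)] using vec.subspace_0[OF L(2)]
    by blast
  also have "pt ` (L - L') = coset_points ?p v"
  proof (intro equalityI subsetI)
    fix x assume "x \<in> pt ` (L - L')"
    then obtain u where u: "u \<in> L" "u \<notin> L'" "x = pt u" by blast
    have "u \<in> vec.span (insert v ?p)"
      using span_insert_hyperplane[OF sub L(1) _ L(3)] u v by blast
    then obtain c where c: "u - c *s v \<in> ?p"
      using sub by (auto simp: vec.span_insert vec.span_eq_iff[THEN iffD2])
    then have "c \<noteq> 0" using u by auto
    moreover have "(1 / c) *s (u - c *s v) \<in> ?p" using vec.subspace_scale[OF sub c] .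
    moreover have "c *s (v + (1 / c) *s (u - c *s v)) = u"
      using \<open>c \<noteq> 0\<close> by (simp add: vec_eq_iff field_simps)
    ultimately show "x \<in> coset_points ?p v"
      unfolding coset_points_def u(3) by (metis image_eqI pt_scale)
  next
    fix x assume "x \<in> coset_points ?p v"
    then obtain w where w: "w \<in> ?p" "x = pt (v + w)" by (auto simp: coset_points_def)
    have "v + w \<notin> L'"
      using vec.subspace_diff[OF L(2), of "v + w" w] w(1) v(2) by auto
    then show "x \<in> pt ` (L - L')"
      using w v(1) vec.subspace_add[OF L(1)] by auto
  qed
  finally show ?thesis .
qed

definition of_sign :: "sign \<Rightarrow> 'a::field \<Rightarrow> bool" where
  "of_sign \<epsilon> c \<longleftrightarrow> c \<noteq> 0 \<and> (is_square c \<longleftrightarrow> \<epsilon> = Pos)"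

lemma of_sign_square_mult: "t \<noteq> 0 \<Longrightarrow> of_sign \<epsilon> (t\<^sup>2 * x) \<longleftrightarrow> of_sign \<epsilon> x"
  by (simp add: of_sign_def is_square_mult_cancel_left)

lemma of_sign_eq_square_mult:
  fixes x y :: "'a::{field,finite}"
  assumes "(2::'a) \<noteq> 0" "of_sign \<epsilon> x" "of_sign \<epsilon> y"
  obtains t where "t \<noteq> 0" "y = t\<^sup>2 * x"
proof -
  have nz: "x \<noteq> 0" "y \<noteq> 0" using assms by (auto simp: of_sign_def)
  have "is_square (x * y)"
    using assms is_square_mult_iff[OF assms(1) nz] by (auto simp: of_sign_def)
  then obtain r where r: "x * y = r\<^sup>2" by (rule is_nth_powerE)
  then have "y = (r / x)\<^sup>2 * x" using nz by (simp add: power2_eq_square field_simps)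
  moreover have "r / x \<noteq> 0" using r nz by auto
  ultimately show thesis using that by blast
qed

lemma points_of_sign_eq_image_pt: "points_of_sign \<sigma> \<epsilon> = pt ` {v. of_sign \<epsilon> (\<sigma> v)}"
  by (cases \<epsilon>) (auto simp: points_of_sign_def of_sign_def is_nth_power_def pt_def)


subsection \<open>The graph of a level set\<close>

context quadratic_space
begin

lemma perp_pt: "perp \<sigma> (pt v) = perp \<sigma> {v}"
  by (simp add: pt_def perp_span)

lemma uminus_mem_level [simp]: "- v \<in> level e \<longleftrightarrow> v \<in> level e"
  by (simp add: level_def)

lemma pt_eq_iff:
  assumes "u \<in> level e" "v \<in> level e" "e \<noteq> 0"
  shows "pt u = pt v \<longleftrightarrow> u = v \<or> u = - v"
proof
  assume "pt u = pt v"
  then obtain c where c: "u = c *s v" using pt_eqD by blast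
  then have "c\<^sup>2 * e = e" using assms(1,2) by (simp add: level_def power2_eq_square)
  then have "c = 1 \<or> c = -1" using assms(3) by (simp add: power2_eq_1_iff)
  then show "u = v \<or> u = - v" using c by auto
qed (use pt_scale[of "-1" v] in auto)

definition level_graph :: "'a \<Rightarrow> ('a ^ 'n) set graph" where
  "level_graph e = \<lparr>verts = pt ` level e, adj = (\<lambda>x y. x \<subseteq> perp \<sigma> y)\<rparr>"

lemma verts_level_graph [simp]: "verts (level_graph e) = pt ` level e"
  by (simp add: level_graph_def)

lemma adj_level_graph [simp]: "adj (level_graph e) (pt u) (pt v) \<longleftrightarrow> bil u v = 0"
  unfolding level_graph_def graph.simps perp_pt pt_subset_iff[OF subspace_perp]
  by (simp add: mem_perp_iff)

end

context finite_quadratic_space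
begin

lemma card_eq_double_card_pt:
  assumes "X \<subseteq> level e" "e \<noteq> 0" "\<And>x. x \<in> X \<Longrightarrow> - x \<in> X"
  shows "card X = 2 * card (pt ` X)"
proof (rule card_two_to_one_image[where h = uminus])
  fix x assume x: "x \<in> X"
  have "- x \<noteq> x"
  proof
    assume "- x = x"
    then have "- bil x x = bil x x" by (metis bil_minus_left)
    with x assms(1,2) show False by (auto simp: level_def uminus_eq_self_iff[OF two])
  qed
  with x assms(3) show "- x \<in> X \<and> - x \<noteq> x" by blast
next
  fix x y assume "x \<in> X" "y \<in> X"
  then show "pt x = pt y \<longleftrightarrow> y = x \<or> y = - x"
    using assms pt_eq_iff[of x e y] by (metis minus_minus subsetD)
qed simp

lemma points_of_sign_eq_level:
  assumes "of_sign \<epsilon> e"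
  shows "points_of_sign \<sigma> \<epsilon> = pt ` level e"
proof (intro equalityI subsetI)
  fix x assume "x \<in> points_of_sign \<sigma> \<epsilon>"
  then obtain v where v: "of_sign \<epsilon> (bil v v)" "x = pt v"
    by (auto simp: points_of_sign_eq_image_pt bil_self)
  obtain t where t: "t \<noteq> 0" "e = t\<^sup>2 * bil v v"
    using of_sign_eq_square_mult[OF two v(1) assms] .
  have "t *s v \<in> level e" using t by (simp add: level_def power2_eq_square)
  then show "x \<in> pt ` level e" unfolding v(2) using pt_scale[OF t(1), of v] by (metis imageI)
next
  fix x assume "x \<in> pt ` level e"
  then show "x \<in> points_of_sign \<sigma> \<epsilon>"
    using assms by (auto simp: points_of_sign_eq_image_pt level_def simp flip: bil_self)
qed

lemma of_sign_if_pt_mem: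
  assumes "pt v \<in> points_of_sign \<sigma> \<epsilon>"
  shows "of_sign \<epsilon> (bil v v)"
proof -
  obtain u where u: "pt u = pt v" "of_sign \<epsilon> (bil u u)"
    using assms by (auto simp: points_of_sign_eq_image_pt bil_self)
  obtain c where c: "u = c *s v" using pt_eqD[OF u(1)] by blast
  then have "bil u u = c\<^sup>2 * bil v v" by (simp add: power2_eq_square)
  moreover have "c \<noteq> 0" using u(2) c by (auto simp: of_sign_def)
  ultimately show ?thesis using u(2) by (simp add: of_sign_square_mult)
qed

lemma polar_graph_eq_level_graph: "of_sign \<epsilon> e \<Longrightarrow> polar_graph \<sigma> \<epsilon> = level_graph e"
  by (simp add: polar_graph_def level_graph_def points_of_sign_eq_level)

end


subsection \<open>The switching set\<close>

locale isotropic_subspace = finite_quadratic_space \<sigma>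
  for \<sigma> :: "'a::{field,finite} ^ 'n \<Rightarrow> 'a" +
  fixes p :: "('a ^ 'n) set" and e :: 'a
  assumes subspace: "vec.subspace p"
    and isotropic: "totally_isotropic \<sigma> p"
    and e_nonzero: "e \<noteq> 0"
begin

abbreviation tangents :: "('a ^ 'n) set" where
  "tangents \<equiv> level e \<inter> perp \<sigma> p"

lemma bil_isotropic: "w \<in> p \<Longrightarrow> w' \<in> p \<Longrightarrow> bil w w' = 0"
  using isotropic by (auto simp: totally_isotropic_def mem_perp_iff)

lemma bil_perp: "u \<in> perp \<sigma> p \<Longrightarrow> w \<in> p \<Longrightarrow> bil u w = 0"
  "u \<in> perp \<sigma> p \<Longrightarrow> w \<in> p \<Longrightarrow> bil w u = 0"
  by (simp_all add: mem_perp_iff bil_commute[of w])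

lemma add_mem_tangents: "v \<in> tangents \<Longrightarrow> w \<in> p \<Longrightarrow> v + w \<in> tangents"
  by (auto simp: level_def mem_perp_iff bil_isotropic bil_perp)

lemma pt_mem_coset_points: "pt v \<in> coset_points p v"
  using vec.subspace_0[OF subspace] by (force simp: coset_points_def)

lemma coset_points_subset: "v \<in> tangents \<Longrightarrow> coset_points p v \<subseteq> pt ` level e"
  using add_mem_tangents by (auto simp: coset_points_def)

lemma inj_on_pt_coset:
  assumes v: "v \<in> tangents"
  shows "inj_on (\<lambda>w. pt (v + w)) p"
proof (rule inj_onI)
  fix w w' assume w: "w \<in> p" "w' \<in> p" and "pt (v + w) = pt (v + w')"
  then have "v + w = v + w' \<or> v + w = - (v + w')"
    using pt_eq_iff[of "v + w" e "v + w'"] add_mem_tangents[OF v] e_nonzero by blast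
  moreover have "v + w \<noteq> - (v + w')"
  proof
    assume "v + w = - (v + w')"
    then have "bil (v + w) v = bil (- (v + w')) v" by (rule arg_cong)
    then have "- e = e" using v w by (simp add: level_def bil_perp)
    with e_nonzero show False by (simp add: uminus_eq_self_iff[OF two])
  qed
  ultimately show "w = w'" by simp
qed

lemma card_coset_points: "v \<in> tangents \<Longrightarrow> card (coset_points p v) = card p"
  unfolding coset_points_def by (rule card_image[OF inj_on_pt_coset])

lemma coset_point_eq:
  assumes "v \<in> tangents" "u \<in> level e" "pt u \<in> coset_points p v"
  obtains w where "w \<in> p" "u = v + w \<or> u = - (v + w)"
  using assms pt_eq_iff[of u e] add_mem_tangents e_nonzero unfolding coset_points_def by blast

lemma coset_point_perp:
  assumes "v \<in> tangents" "u \<in> level e" "pt u \<in> coset_points p v"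
  shows "u \<in> perp \<sigma> p"
proof -
  obtain w where "w \<in> p" "u = v + w \<or> u = - (v + w)" using coset_point_eq[OF assms] .
  then show ?thesis
    using add_mem_tangents[OF assms(1)] vec.subspace_neg[OF subspace_perp] by blast
qed

lemma bil_coset_point:
  assumes "v \<in> tangents" "u \<in> level e" "pt u \<in> coset_points p v" "x \<in> perp \<sigma> p"
  shows "bil u x = 0 \<longleftrightarrow> bil v x = 0"
proof -
  obtain w where "w \<in> p" "u = v + w \<or> u = - (v + w)" using coset_point_eq[OF assms(1-3)] .
  then show ?thesis using assms(4) by (auto simp: bil_perp)
qed

lemma nbhd_Int_coset_points:
  assumes "v \<in> tangents"
  shows "nbhd (level_graph e) (pt u) \<inter> coset_points p v
    = (\<lambda>w. pt (v + w)) ` {w \<in> p. bil u (v + w) = 0}"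
  using coset_points_subset[OF assms] by (auto simp: nbhd_def coset_points_def)

lemma nbhd_Int_coset_points_perp:
  assumes "v \<in> tangents" "u \<in> perp \<sigma> p"
  shows "nbhd (level_graph e) (pt u) \<inter> coset_points p v
    = (if bil u v = 0 then coset_points p v else {})"
  unfolding nbhd_Int_coset_points[OF assms(1)] using assms(2)
  by (auto simp: coset_points_def bil_perp)

lemma card_nbhd_Int_coset_points:
  assumes "v \<in> tangents"
  shows "card (nbhd (level_graph e) (pt u) \<inter> coset_points p v) = card {w \<in> p. bil u (v + w) = 0}"
  unfolding nbhd_Int_coset_points[OF assms]
  by (rule card_image) (rule inj_on_subset[OF inj_on_pt_coset[OF assms]], blast)

lemma ex_bil_eq:
  assumes "u \<notin> perp \<sigma> p"
  obtains w where "w \<in> p" "bil u w = c"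
proof -
  obtain w where w: "w \<in> p" "bil u w \<noteq> 0" using assms by (auto simp: mem_perp_iff)
  then show thesis
    using that[of "(c / bil u w) *s w"] vec.subspace_scale[OF subspace] by simp
qed

lemma nbhd_Int_coset_points_nonempty:
  assumes "v \<in> tangents" "u \<notin> perp \<sigma> p"
  shows "nbhd (level_graph e) (pt u) \<inter> coset_points p v \<noteq> {}"
proof -
  obtain w where "w \<in> p" "bil u w = - bil u v" using ex_bil_eq[OF assms(2)] .
  then show ?thesis unfolding nbhd_Int_coset_points[OF assms(1)] by force
qed

lemma card_nbhd_Int_coset_points_eq:
  assumes "v \<in> tangents" "v' \<in> tangents" "u \<notin> perp \<sigma> p"
  shows "card (nbhd (level_graph e) (pt u) \<inter> coset_points p v)
    = card (nbhd (level_graph e) (pt u) \<inter> coset_points p v')"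
proof -
  obtain t where t: "t \<in> p" "bil u t = bil u v - bil u v'" using ex_bil_eq[OF assms(3)] .
  have "bij_betw (\<lambda>w. w + t) {w \<in> p. bil u (v + w) = 0} {w \<in> p. bil u (v' + w) = 0}"
    by (rule bij_betw_byWitness[where f' = "\<lambda>w. w - t"])
       (use t subspace in \<open>auto simp: vec.subspace_add vec.subspace_diff add.commute\<close>)
  then show ?thesis
    by (simp only: card_nbhd_Int_coset_points assms(1,2) bij_betw_same_card)
qed

lemma card_nbhd_coset_point:
  assumes "v \<in> tangents" "v' \<in> tangents" "x \<in> coset_points p v"
  shows "card (nbhd (level_graph e) x \<inter> coset_points p v') = (if bil v v' = 0 then card p else 0)"
proof -
  obtain w where w: "w \<in> p" "x = pt (v + w)" using assms(3) by (auto simp: coset_points_def)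
  have "v + w \<in> perp \<sigma> p" "bil (v + w) v' = bil v v'"
    using add_mem_tangents[OF assms(1) w(1)] w(1) assms(2) by (simp_all add: bil_perp)
  then show ?thesis
    using nbhd_Int_coset_points_perp[OF assms(2)] card_coset_points[OF assms(2)] w(2) by simp
qed

lemma induced_regular_coset_points_Un:
  assumes v: "v \<in> tangents" "v' \<in> tangents"
    and disjoint: "coset_points p v \<inter> coset_points p v' = {}"
  shows "induced_regular (level_graph e) (coset_points p v \<union> coset_points p v')
    (if bil v v' = 0 then card p else 0)"
  unfolding induced_regular_def
proof
  let ?N = "nbhd (level_graph e)" and ?C = "coset_points p v" and ?C' = "coset_points p v'"
  fix x assume "x \<in> ?C \<union> ?C'"
  moreover have "card (?N x \<inter> (?C \<union> ?C')) = card (?N x \<inter> ?C) + card (?N x \<inter> ?C')"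
    unfolding Int_Un_distrib by (rule card_Un_disjoint) (use disjoint in auto)
  moreover have "bil v v \<noteq> 0" "bil v' v' \<noteq> 0" using v e_nonzero by (auto simp: level_def)
  ultimately show "card (?N x \<inter> (?C \<union> ?C')) = (if bil v v' = 0 then card p else 0)"
    using card_nbhd_coset_point v bil_commute[of v' v] by auto
qed

lemma switching_set_coset_points:
  assumes v: "v \<in> tangents" "v' \<in> tangents"
    and disjoint: "coset_points p v \<inter> coset_points p v' = {}"
  shows "switching_set (level_graph e) (coset_points p v) (coset_points p v')"
  unfolding switching_set_def
proof (intro conjI)
  let ?N = "nbhd (level_graph e)" and ?C = "coset_points p v" and ?C' = "coset_points p v'"
  show "card ?C = card ?C'" using v by (simp add: card_coset_points)
  have "induced_regular (level_graph e) (coset_points p u) 0" if "u \<in> tangents" for u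
    unfolding induced_regular_def using card_nbhd_coset_point[OF that that] that e_nonzero
    by (simp add: level_def)
  then show "\<exists>k. induced_regular (level_graph e) ?C k \<and> induced_regular (level_graph e) ?C' k"
    using v by blast
  show "\<exists>l. induced_regular (level_graph e) (?C \<union> ?C') l"
    using induced_regular_coset_points_Un[OF assms] by blast
  show "\<forall>x\<in>verts (level_graph e) - (?C \<union> ?C').
      card (?N x \<inter> ?C) = card (?N x \<inter> ?C') \<or> ?N x \<inter> (?C \<union> ?C') \<in> {?C, ?C'}"
  proof
    fix x assume "x \<in> verts (level_graph e) - (?C \<union> ?C')"
    then obtain u where x: "x = pt u" by auto
    show "card (?N x \<inter> ?C) = card (?N x \<inter> ?C') \<or> ?N x \<inter> (?C \<union> ?C') \<in> {?C, ?C'}"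
    proof (cases "u \<in> perp \<sigma> p")
      case True
      have "?N x \<inter> ?C = (if bil u v = 0 then ?C else {})"
        "?N x \<inter> ?C' = (if bil u v' = 0 then ?C' else {})"
        using nbhd_Int_coset_points_perp True v unfolding x by blast+
      moreover have "card ?C = card ?C'" using v by (simp add: card_coset_points)
      ultimately show ?thesis by (simp add: Int_Un_distrib)
    next
      case False
      then show ?thesis using card_nbhd_Int_coset_points_eq[OF v] x by blast
    qed
  qed
qed (use coset_points_subset v disjoint in auto)

end

lemma adj_switch:
  shows adj_switch_from: "x \<in> verts G - (C\<^sub>1 \<union> C\<^sub>2) \<Longrightarrow> y \<in> C\<^sub>1 \<union> C\<^sub>2 \<Longrightarrow>
      adj (switch G C\<^sub>1 C\<^sub>2) x y \<longleftrightarrow> y \<in> switched_nbhd G C\<^sub>1 C\<^sub>2 x"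
    and adj_switch_to: "x \<in> C\<^sub>1 \<union> C\<^sub>2 \<Longrightarrow> y \<in> verts G - (C\<^sub>1 \<union> C\<^sub>2) \<Longrightarrow>
      adj (switch G C\<^sub>1 C\<^sub>2) x y \<longleftrightarrow> x \<in> switched_nbhd G C\<^sub>1 C\<^sub>2 y"
    and adj_switch_outside: "x \<notin> C\<^sub>1 \<union> C\<^sub>2 \<Longrightarrow> y \<notin> C\<^sub>1 \<union> C\<^sub>2 \<Longrightarrow>
      adj (switch G C\<^sub>1 C\<^sub>2) x y \<longleftrightarrow> adj G x y"
    and adj_switch_inside: "x \<in> C\<^sub>1 \<union> C\<^sub>2 \<Longrightarrow> y \<in> C\<^sub>1 \<union> C\<^sub>2 \<Longrightarrow>
      adj (switch G C\<^sub>1 C\<^sub>2) x y \<longleftrightarrow> adj G x y"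
  unfolding switch_def Let_def graph.simps
  by (simp_all only: Diff_iff simp_thms if_True if_False)

lemma verts_switch [simp]: "verts (switch G C\<^sub>1 C\<^sub>2) = verts G"
  by (simp add: switch_def)

lemma switched_nbhd_if_nbhd_eq:
  assumes "C\<^sub>1 \<noteq> {}" "C\<^sub>2 \<noteq> {}" "C\<^sub>1 \<inter> C\<^sub>2 = {}"
    and "nbhd G x \<inter> C\<^sub>1 = (if P then C\<^sub>1 else {})" "nbhd G x \<inter> C\<^sub>2 = (if Q then C\<^sub>2 else {})"
  shows "switched_nbhd G C\<^sub>1 C\<^sub>2 x = (if Q then C\<^sub>1 else {}) \<union> (if P then C\<^sub>2 else {})"
proof -
  have "C\<^sub>1 \<noteq> C\<^sub>2" "C\<^sub>1 \<union> C\<^sub>2 \<noteq> C\<^sub>1" "C\<^sub>1 \<union> C\<^sub>2 \<noteq> C\<^sub>2" "{} \<noteq> C\<^sub>1" "{} \<noteq> C\<^sub>2" using assms(1-3) by blast+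
  then show ?thesis
    unfolding switched_nbhd_def Let_def Int_Un_distrib assms(4,5) by (cases P; cases Q) simp_all
qed

locale tangent_pair = isotropic_subspace \<sigma> p e
  for \<sigma> :: "'a::{field,finite} ^ 'n \<Rightarrow> 'a" and p e +
  fixes v\<^sub>1 v\<^sub>2 :: "'a ^ 'n"
  assumes v\<^sub>1: "v\<^sub>1 \<in> tangents" and v\<^sub>2: "v\<^sub>2 \<in> tangents"
    and disjoint: "coset_points p v\<^sub>1 \<inter> coset_points p v\<^sub>2 = {}"
begin

lemma bil_v\<^sub>1 [simp]: "bil v\<^sub>1 v\<^sub>1 = e" and bil_v\<^sub>2 [simp]: "bil v\<^sub>2 v\<^sub>2 = e"
  using v\<^sub>1 v\<^sub>2 by (simp_all add: level_def)

abbreviation C\<^sub>1 :: "('a ^ 'n) set set" where "C\<^sub>1 \<equiv> coset_points p v\<^sub>1"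

abbreviation C\<^sub>2 :: "('a ^ 'n) set set" where "C\<^sub>2 \<equiv> coset_points p v\<^sub>2"

abbreviation \<Gamma> :: "('a ^ 'n) set graph" where "\<Gamma> \<equiv> level_graph e"

abbreviation \<Gamma>' :: "('a ^ 'n) set graph" where "\<Gamma>' \<equiv> switch \<Gamma> C\<^sub>1 C\<^sub>2"

lemma switched_nbhd_perp:
  assumes "u \<in> perp \<sigma> p"
  shows "switched_nbhd \<Gamma> C\<^sub>1 C\<^sub>2 (pt u)
    = (if bil u v\<^sub>2 = 0 then C\<^sub>1 else {}) \<union> (if bil u v\<^sub>1 = 0 then C\<^sub>2 else {})"
  using pt_mem_coset_points[of v\<^sub>1] pt_mem_coset_points[of v\<^sub>2] disjoint
    nbhd_Int_coset_points_perp[OF v\<^sub>1 assms] nbhd_Int_coset_points_perp[OF v\<^sub>2 assms]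
  by (intro switched_nbhd_if_nbhd_eq) auto

lemma switched_nbhd_nonperp:
  assumes "u \<notin> perp \<sigma> p"
  shows "switched_nbhd \<Gamma> C\<^sub>1 C\<^sub>2 (pt u) = nbhd \<Gamma> (pt u) \<inter> (C\<^sub>1 \<union> C\<^sub>2)"
proof -
  have "nbhd \<Gamma> (pt u) \<inter> (C\<^sub>1 \<union> C\<^sub>2) \<noteq> C\<^sub>1" "nbhd \<Gamma> (pt u) \<inter> (C\<^sub>1 \<union> C\<^sub>2) \<noteq> C\<^sub>2"
    using disjoint nbhd_Int_coset_points_nonempty[OF v\<^sub>1 assms]
      nbhd_Int_coset_points_nonempty[OF v\<^sub>2 assms] by blast+
  then show ?thesis unfolding switched_nbhd_def Let_def by (simp only: if_False)
qed

lemma pt_v\<^sub>1_mem_switched_nbhd: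
  "pt v\<^sub>1 \<in> switched_nbhd \<Gamma> C\<^sub>1 C\<^sub>2 (pt u) \<longleftrightarrow> bil u (if u \<in> perp \<sigma> p then v\<^sub>2 else v\<^sub>1) = 0"
proof (cases "u \<in> perp \<sigma> p")
  case True
  have "pt v\<^sub>1 \<in> C\<^sub>1" "pt v\<^sub>1 \<notin> C\<^sub>2" using pt_mem_coset_points disjoint by blast+
  then show ?thesis using True by (simp add: switched_nbhd_perp)
next
  case False
  have "pt v\<^sub>1 \<in> C\<^sub>1" "pt v\<^sub>1 \<in> verts \<Gamma>" using pt_mem_coset_points v\<^sub>1 by auto
  then show ?thesis using False by (simp add: switched_nbhd_nonperp nbhd_def)
qed

end


subsection \<open>Common neighbours of cliques\<close>

definition clique :: "'v graph \<Rightarrow> 'v set \<Rightarrow> bool" where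
  "clique G K \<longleftrightarrow> K \<subseteq> verts G \<and> (\<forall>x\<in>K. \<forall>y\<in>K. x \<noteq> y \<longrightarrow> adj G x y)"

definition common_nbhd :: "'v graph \<Rightarrow> 'v set \<Rightarrow> 'v set" where
  "common_nbhd G K = {x \<in> verts G. \<forall>y\<in>K. adj G x y}"

lemma graph_iso_clique:
  assumes "graph_iso G H" and K: "clique G K"
  obtains K' where "clique H K'" "card K' = card K"
    "card (common_nbhd H K') = card (common_nbhd G K)"
proof -
  obtain f where f: "bij_betw f (verts G) (verts H)"
    and adj: "\<And>x y. x \<in> verts G \<Longrightarrow> y \<in> verts G \<Longrightarrow> adj H (f x) (f y) \<longleftrightarrow> adj G x y"
    using assms(1) unfolding graph_iso_def by blast
  have inj: "inj_on f (verts G)" and img: "f ` verts G = verts H"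
    using f by (auto simp: bij_betw_def)
  have sub: "K \<subseteq> verts G" "common_nbhd G K \<subseteq> verts G" using K
    by (auto simp: clique_def common_nbhd_def)
  have "common_nbhd H (f ` K) = f ` common_nbhd G K"
    unfolding common_nbhd_def img[symmetric] using adj sub(1) by (auto simp: subset_iff)
  then have "card (common_nbhd H (f ` K)) = card (common_nbhd G K)"
    using card_image[OF inj_on_subset[OF inj sub(2)]] by simp
  moreover have "clique H (f ` K)"
    using K adj img sub(1) unfolding clique_def by (auto simp: subset_iff)
  moreover have "card (f ` K) = card K" using card_image[OF inj_on_subset[OF inj sub(1)]] .
  ultimately show thesis using that by blast
qed

lemma (in quadratic_space) orthogonal_frame_distinct_pt:
  "orthogonal_frame us \<Longrightarrow> distinct (map pt us)"
proof (induction us)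
  case (Cons u us)
  have "pt u \<noteq> pt v" if "v \<in> set us" for v
  proof
    assume "pt u = pt v"
    then obtain c where "u = c *s v" using pt_eqD by blast
    moreover have "bil u v = 0" using Cons.prems that by (simp add: mem_perp_iff)
    ultimately show False using Cons.prems by simp
  qed
  then show ?case using Cons by auto
qed simp

context finite_quadratic_space
begin

lemma clique_level_graphE:
  assumes "clique (level_graph e) K" "e \<noteq> 0"
  obtains us where "orthogonal_frame us" "set us \<subseteq> level e" "K = pt ` set us"
proof -
  have "\<forall>x\<in>K. \<exists>u. u \<in> level e \<and> pt u = x"
    using assms(1) by (auto simp: clique_def)
  then obtain h where h: "\<And>x. x \<in> K \<Longrightarrow> h x \<in> level e" "\<And>x. x \<in> K \<Longrightarrow> pt (h x) = x"
    by metis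
  obtain xs where xs: "set xs = K" "distinct xs" using finite_distinct_list[of K] by auto
  have "bil (h x) (h y) = 0" if "x \<in> K" "y \<in> K" "x \<noteq> y" for x y
    using assms(1) that h(2)[OF that(1)] h(2)[OF that(2)] adj_level_graph
    unfolding clique_def by metis
  moreover have "inj_on h K" using h(2) by (metis inj_onI)
  ultimately have "orthogonal_frame (map h xs)"
    using h(1) xs assms(2)
    by (auto simp: orthogonal_frame_def level_def pairwise_def distinct_map)
  then show thesis
    by (rule that) (use h xs(1) in \<open>auto simp: image_image\<close>)
qed

lemma card_level_perp:
  assumes "e \<noteq> 0"
  shows "card (level e \<inter> perp \<sigma> S) = 2 * card (common_nbhd (level_graph e) (pt ` S))"
proof -
  have "common_nbhd (level_graph e) (pt ` S) = pt ` (level e \<inter> perp \<sigma> S)"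
    by (auto simp: common_nbhd_def mem_perp_iff)
  then show ?thesis
    using card_eq_double_card_pt[of "level e \<inter> perp \<sigma> S" e] assms by (simp add: mem_perp_iff)
qed

lemma card_common_nbhd_clique_eq:
  assumes "clique (level_graph e) K" "clique (level_graph e) K'" "card K = card K'" "e \<noteq> 0"
  shows "card (common_nbhd (level_graph e) K) = card (common_nbhd (level_graph e) K')"
proof -
  obtain us where us: "orthogonal_frame us" "set us \<subseteq> level e" "K = pt ` set us"
    using clique_level_graphE[OF assms(1,4)] .
  obtain vs where vs: "orthogonal_frame vs" "set vs \<subseteq> level e" "K' = pt ` set vs"
    using clique_level_graphE[OF assms(2,4)] .
  have "length us = card K" "length vs = card K'"
    using distinct_card[OF orthogonal_frame_distinct_pt] us vs by fastforce+
  moreover have "map (\<lambda>u. bil u u) ws = replicate (length ws) e" if "set ws \<subseteq> level e" for ws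
    using that by (induction ws) (auto simp: level_def)
  ultimately have "card (level e \<inter> perp \<sigma> (set us)) = card (level e \<inter> perp \<sigma> (set vs))"
    using us vs assms(3) by (intro card_level_perp_frame_eq) auto
  then show ?thesis unfolding card_level_perp[OF assms(4)] us(3) vs(3) by simp
qed

end

text \<open>In \<open>\<Gamma>'\<close> the vectors \<open>ks\<close> form a clique with \<open>v\<^sub>1\<close>, in \<open>\<Gamma>\<close> with \<open>v\<^sub>2\<close>. The last assumption
  prevents points of \<open>C\<^sub>1\<close> and \<open>C\<^sub>2\<close> from being common neighbours.\<close>

locale switched_clique = tangent_pair \<sigma> p e v\<^sub>1 v\<^sub>2
  for \<sigma> :: "'a::{field,finite} ^ 'n \<Rightarrow> 'a" and p e v\<^sub>1 v\<^sub>2 +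
  fixes ks :: "('a ^ 'n) list"
  assumes frame: "orthogonal_frame (v\<^sub>2 # ks)" and ks_level: "set ks \<subseteq> level e"
    and pt_notin_C\<^sub>1: "k \<in> set ks \<Longrightarrow> pt k \<notin> C\<^sub>1"
    and bil_v\<^sub>1_if_not_perp: "k \<in> set ks \<Longrightarrow> k \<notin> perp \<sigma> p \<Longrightarrow> bil k v\<^sub>1 = 0"
    and ex_perp_not_v\<^sub>1: "\<exists>k\<in>set ks. k \<in> perp \<sigma> p \<and> bil k v\<^sub>1 \<noteq> 0"
begin

lemma bil_ks_v\<^sub>2: "k \<in> set ks \<Longrightarrow> bil k v\<^sub>2 = 0"
  using frame by (simp add: mem_perp_iff bil_commute[of k])

lemma pt_notin_C:
  assumes "k \<in> set ks"
  shows "pt k \<notin> C\<^sub>1 \<union> C\<^sub>2"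
proof -
  have "pt k \<notin> C\<^sub>2"
    using bil_coset_point[OF v\<^sub>2, of k v\<^sub>2] bil_ks_v\<^sub>2[OF assms] v\<^sub>2 e_nonzero assms ks_level by auto
  with pt_notin_C\<^sub>1[OF assms] show ?thesis by blast
qed

lemma adj_switch_outside_v\<^sub>1:
  assumes "u \<in> level e" "pt u \<notin> C\<^sub>1 \<union> C\<^sub>2"
  shows "adj \<Gamma>' (pt u) (pt v\<^sub>1) \<longleftrightarrow> bil u (if u \<in> perp \<sigma> p then v\<^sub>2 else v\<^sub>1) = 0"
    and "adj \<Gamma>' (pt v\<^sub>1) (pt u) \<longleftrightarrow> bil u (if u \<in> perp \<sigma> p then v\<^sub>2 else v\<^sub>1) = 0"
proof -
  have "pt u \<in> verts \<Gamma> - (C\<^sub>1 \<union> C\<^sub>2)" "pt v\<^sub>1 \<in> C\<^sub>1 \<union> C\<^sub>2"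
    using assms pt_mem_coset_points by auto
  then show "adj \<Gamma>' (pt u) (pt v\<^sub>1) \<longleftrightarrow> bil u (if u \<in> perp \<sigma> p then v\<^sub>2 else v\<^sub>1) = 0"
    and "adj \<Gamma>' (pt v\<^sub>1) (pt u) \<longleftrightarrow> bil u (if u \<in> perp \<sigma> p then v\<^sub>2 else v\<^sub>1) = 0"
    by (simp_all only: adj_switch_from adj_switch_to pt_v\<^sub>1_mem_switched_nbhd)
qed

lemma clique_switch: "clique \<Gamma>' (pt ` set (v\<^sub>1 # ks))"
proof -
  have "adj \<Gamma>' (pt k) (pt v\<^sub>1) \<and> adj \<Gamma>' (pt v\<^sub>1) (pt k)" if "k \<in> set ks" for k
    using that adj_switch_outside_v\<^sub>1[OF _ pt_notin_C[OF that]] ks_level bil_ks_v\<^sub>2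
      bil_v\<^sub>1_if_not_perp by auto
  moreover have "adj \<Gamma>' (pt k) (pt l)" if "k \<in> set ks" "l \<in> set ks" "k \<noteq> l" for k l
    using adj_switch_outside[OF pt_notin_C[OF that(1)] pt_notin_C[OF that(2)]]
      orthogonal_frame_bil[OF frame] that by simp
  moreover have "pt ` set (v\<^sub>1 # ks) \<subseteq> verts \<Gamma>'" using v\<^sub>1 ks_level by auto
  ultimately show ?thesis unfolding clique_def by auto
qed

lemma card_switched_clique: "card (pt ` set (v\<^sub>1 # ks)) = card (pt ` set (v\<^sub>2 # ks))"
proof -
  have "pt v\<^sub>1 \<notin> pt ` set ks" using pt_notin_C pt_mem_coset_points by (metis UnI1 imageE)
  moreover have "pt v\<^sub>2 \<notin> pt ` set ks" using orthogonal_frame_distinct_pt[OF frame] by simp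
  ultimately show ?thesis by simp
qed

lemma coset_not_common_nbr:
  assumes u: "u \<in> level e" "pt u \<in> C\<^sub>1 \<union> C\<^sub>2"
  shows "u \<in> perp \<sigma> p" "u \<notin> perp \<sigma> (set (v\<^sub>2 # ks))"
    and "\<exists>k\<in>set (v\<^sub>1 # ks). \<not> adj \<Gamma>' (pt u) (pt k)"
proof -
  obtain k where k: "k \<in> set ks" "k \<in> perp \<sigma> p" "bil v\<^sub>1 k \<noteq> 0"
    using ex_perp_not_v\<^sub>1 bil_commute by metis
  have v\<^sub>1C: "pt v\<^sub>1 \<in> C\<^sub>1 \<union> C\<^sub>2" using pt_mem_coset_points by blast
  show "u \<in> perp \<sigma> p" using u coset_point_perp v\<^sub>1 v\<^sub>2 by blast
  consider "pt u \<in> C\<^sub>1" | "pt u \<in> C\<^sub>2" using u(2) by blast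
  then have "u \<notin> perp \<sigma> (set (v\<^sub>2 # ks)) \<and> (\<exists>k\<in>set (v\<^sub>1 # ks). \<not> adj \<Gamma>' (pt u) (pt k))"
  proof cases
    case 1
    have "bil u k \<noteq> 0" "bil u v\<^sub>1 \<noteq> 0"
      using bil_coset_point[OF v\<^sub>1 u(1) 1] v\<^sub>1 k e_nonzero by auto
    then show ?thesis using k(1) adj_switch_inside[OF u(2) v\<^sub>1C, of \<Gamma>]
      by (auto simp: mem_perp_iff)
  next
    case 2
    have "bil u v\<^sub>2 \<noteq> 0" using bil_coset_point[OF v\<^sub>2 u(1) 2] v\<^sub>2 e_nonzero by auto
    moreover have "\<not> adj \<Gamma>' (pt u) (pt k)"
    proof -
      have "pt k \<in> verts \<Gamma> - (C\<^sub>1 \<union> C\<^sub>2)" using pt_notin_C[OF k(1)] k(1) ks_level by auto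
      moreover have "switched_nbhd \<Gamma> C\<^sub>1 C\<^sub>2 (pt k) = C\<^sub>1"
        using switched_nbhd_perp[OF k(2)] bil_ks_v\<^sub>2[OF k(1)] k(3) by (simp add: bil_commute)
      ultimately show ?thesis using adj_switch_to[OF u(2)] 2 disjoint by blast
    qed
    ultimately show ?thesis using k(1) by (auto simp: mem_perp_iff)
  qed
  then show "u \<notin> perp \<sigma> (set (v\<^sub>2 # ks))" "\<exists>k\<in>set (v\<^sub>1 # ks). \<not> adj \<Gamma>' (pt u) (pt k)"
    by blast+
qed

lemma common_nbhd_switch:
  "common_nbhd \<Gamma>' (pt ` set (v\<^sub>1 # ks)) =
     pt ` (level e \<inter> (perp \<sigma> (set (v\<^sub>2 # ks)) \<inter> perp \<sigma> p \<union> (perp \<sigma> (set (v\<^sub>1 # ks)) - perp \<sigma> p)))"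
proof -
  have "(\<forall>k\<in>set (v\<^sub>1 # ks). adj \<Gamma>' (pt u) (pt k)) \<longleftrightarrow>
      u \<in> perp \<sigma> (set (v\<^sub>2 # ks)) \<inter> perp \<sigma> p \<union> (perp \<sigma> (set (v\<^sub>1 # ks)) - perp \<sigma> p)"
    if u: "u \<in> level e" for u
  proof (cases "pt u \<in> C\<^sub>1 \<union> C\<^sub>2")
    case True
    then show ?thesis using coset_not_common_nbr[OF u True] by blast
  next
    case False
    have "adj \<Gamma>' (pt u) (pt k) \<longleftrightarrow> bil u k = 0" if "k \<in> set ks" for k
      using False pt_notin_C[OF that] by (simp add: adj_switch_outside)
    then show ?thesis
      using adj_switch_outside_v\<^sub>1(1)[OF u False] by (auto simp: mem_perp_iff[of _ "insert _ _"])
  qed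
  then show ?thesis unfolding common_nbhd_def by auto
qed

lemma not_graph_iso_switch:
  assumes "card (level e \<inter> perp \<sigma> (set (v\<^sub>1 # ks)) - perp \<sigma> p)
    \<noteq> card (level e \<inter> perp \<sigma> (set (v\<^sub>2 # ks)) - perp \<sigma> p)"
  shows "\<not> graph_iso \<Gamma>' \<Gamma>"
proof
  define X Y\<^sub>1 Y\<^sub>2 where "X = level e \<inter> perp \<sigma> (set (v\<^sub>2 # ks)) \<inter> perp \<sigma> p"
    and "Y\<^sub>1 = level e \<inter> perp \<sigma> (set (v\<^sub>1 # ks)) - perp \<sigma> p"
    and "Y\<^sub>2 = level e \<inter> perp \<sigma> (set (v\<^sub>2 # ks)) - perp \<sigma> p"
  assume "graph_iso \<Gamma>' \<Gamma>"
  then obtain K where K: "clique \<Gamma> K" "card K = card (pt ` set (v\<^sub>2 # ks))"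
    "card (common_nbhd \<Gamma> K) = card (common_nbhd \<Gamma>' (pt ` set (v\<^sub>1 # ks)))"
    using graph_iso_clique[OF _ clique_switch] card_switched_clique by metis
  have "clique \<Gamma> (pt ` set (v\<^sub>2 # ks))"
    using v\<^sub>2 ks_level orthogonal_frame_bil[OF frame] by (auto simp: clique_def)
  then have "card (common_nbhd \<Gamma>' (pt ` set (v\<^sub>1 # ks))) = card (common_nbhd \<Gamma> (pt ` set (v\<^sub>2 # ks)))"
    using card_common_nbhd_clique_eq[OF K(1) _ K(2) e_nonzero] K(3) by simp
  moreover have "common_nbhd \<Gamma>' (pt ` set (v\<^sub>1 # ks)) = pt ` (X \<union> Y\<^sub>1)"
    unfolding common_nbhd_switch X_def Y\<^sub>1_def by (rule arg_cong[where f = "image pt"]) blast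
  moreover have "card (X \<union> Y\<^sub>1) = 2 * card (pt ` (X \<union> Y\<^sub>1))"
    using e_nonzero by (intro card_eq_double_card_pt) (auto simp: X_def Y\<^sub>1_def mem_perp_iff)
  moreover have "X \<union> Y\<^sub>2 = level e \<inter> perp \<sigma> (set (v\<^sub>2 # ks))"
    unfolding X_def Y\<^sub>2_def by blast
  ultimately have "card (X \<union> Y\<^sub>1) = card (X \<union> Y\<^sub>2)"
    using card_level_perp[OF e_nonzero, of "set (v\<^sub>2 # ks)"] by simp
  moreover have "X \<inter> Y\<^sub>1 = {}" "X \<inter> Y\<^sub>2 = {}" unfolding X_def Y\<^sub>1_def Y\<^sub>2_def by blast+
  ultimately have "card Y\<^sub>1 = card Y\<^sub>2" by (simp add: card_Un_disjoint)
  with assms show False unfolding Y\<^sub>1_def Y\<^sub>2_def by blast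
qed

end


subsection \<open>A clique with the wrong number of common neighbours\<close>

lemma (in quadratic_space) orthogonal_frame_expansion:
  assumes frame: "orthogonal_frame us" and "length us = CARD('n)"
  shows "u = (\<Sum>w\<in>set us. (bil u w / bil w w) *s w)"
proof -
  let ?s = "\<Sum>w\<in>set us. (bil u w / bil w w) *s w"
  have bil_sum: "bil (sum f A) v = (\<Sum>w\<in>A. bil (f w) v)" for f :: "'a ^ 'n \<Rightarrow> 'a ^ 'n" and A v
    by (induction A rule: infinite_finite_induct) simp_all
  have "bil (u - ?s) v = 0" if v: "v \<in> set us" for v
  proof -
    have "bil ?s v = (\<Sum>w\<in>set us. if w = v then bil u v else 0)"
      unfolding bil_sum
    proof (rule sum.cong)
      fix w assume "w \<in> set us"
      then show "bil ((bil u w / bil w w) *s w) v = (if w = v then bil u v else 0)"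
        using orthogonal_frame_bil[OF frame] frame v by (auto simp: orthogonal_frame_def)
    qed simp
    then show ?thesis using v by simp
  qed
  then have "u - ?s \<in> perp \<sigma> (set us)" unfolding mem_perp_iff by blast
  then have "u - ?s = 0" by (rule orthogonal_frame_complete[OF assms])
  then show ?thesis by simp
qed

lemma (in quadratic_space) orthogonal_frame_expansion_three:
  assumes frame: "orthogonal_frame (z # x # y # us)" and len: "length us + 3 = CARD('n)"
    and u: "u \<in> perp \<sigma> (set us)"
  shows "u = (bil u x / bil x x) *s x + (bil u y / bil y y) *s y + (bil u z / bil z z) *s z"
proof -
  have "u = (\<Sum>w\<in>set (z # x # y # us). (bil u w / bil w w) *s w)"
    using orthogonal_frame_expansion[OF frame] len by simp
  also have "\<dots> = (bil u x / bil x x) *s x + (bil u y / bil y y) *s y + (bil u z / bil z z) *s z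
      + (\<Sum>w\<in>set us. (bil u w / bil w w) *s w)"
    using frame by (simp add: orthogonal_frame_def add_ac)
  also have "(\<Sum>w\<in>set us. (bil u w / bil w w) *s w) = 0"
    using u by (simp add: mem_perp_iff)
  finally show ?thesis by simp
qed

context finite_quadratic_space
begin

lemma ex_orthogonal_frame_resolving:
  assumes frame: "orthogonal_frame us" and len: "length us + 4 \<le> CARD('n)"
    and nz: "e \<noteq> 0" "s \<noteq> 0"
  obtains x v\<^sub>0 ys w where "orthogonal_frame (x # v\<^sub>0 # ys @ us)" "length ys + length us + 2 = CARD('n)"
    "set ys \<subseteq> level e" "bil v\<^sub>0 v\<^sub>0 = s * e" "w - v\<^sub>0 \<in> vec.span (set ys)" "bil w w = e"
proof -
  let ?cs = "s * e # e # e # replicate (CARD('n) - length us - 4) e"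
  obtain ws where ws: "orthogonal_frame (ws @ us)" "map (\<lambda>w. bil w w) ws = ?cs"
    by (rule orthogonal_frame_extend_values[of us ?cs]) (use frame len nz in auto)
  obtain v\<^sub>0 y\<^sub>1 y\<^sub>2 ys where ws_eq: "ws = v\<^sub>0 # y\<^sub>1 # y\<^sub>2 # ys"
    and val: "bil v\<^sub>0 v\<^sub>0 = s * e" "bil y\<^sub>1 y\<^sub>1 = e" "bil y\<^sub>2 y\<^sub>2 = e"
    and ys: "map (\<lambda>w. bil w w) ys = replicate (CARD('n) - length us - 4) e"
    using ws(2) by (auto simp: map_eq_Cons_conv)
  have len_ys: "length ys = CARD('n) - length us - 4" using arg_cong[OF ys, of length] by simp
  have ys_level: "set ys \<subseteq> level e"
    using arg_cong[OF ys, of set] by (auto simp: level_def split: if_splits)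
  obtain x where x: "orthogonal_frame (x # ws @ us)"
    by (rule orthogonal_frame_extend[OF ws(1)]) (use len len_ys ws_eq in auto)
  obtain c\<^sub>1 c\<^sub>2 where c: "1 * c\<^sub>1\<^sup>2 + 1 * c\<^sub>2\<^sup>2 = 1 - s"
    using ex_binary_form_value[OF two, of 1 1] by auto
  define w where "w = c\<^sub>1 *s y\<^sub>1 + c\<^sub>2 *s y\<^sub>2 + v\<^sub>0"
  have "bil v\<^sub>0 y\<^sub>1 = 0" "bil v\<^sub>0 y\<^sub>2 = 0" "bil y\<^sub>1 y\<^sub>2 = 0"
    using ws(1) by (auto simp: ws_eq mem_perp_iff)
  then have "bil w w = e * (1 * c\<^sub>1\<^sup>2 + 1 * c\<^sub>2\<^sup>2) + s * e"
    using val bil_commute[of y\<^sub>1 v\<^sub>0] bil_commute[of y\<^sub>2 v\<^sub>0] bil_commute[of y\<^sub>2 y\<^sub>1]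
    by (simp add: w_def power2_eq_square algebra_simps)
  then have "bil w w = e" unfolding c by (simp add: algebra_simps)
  moreover have "w - v\<^sub>0 \<in> vec.span (set (y\<^sub>1 # y\<^sub>2 # ys))"
    by (simp add: w_def vec.span_add vec.span_scale vec.span_base)
  ultimately show thesis
    using that[of x v\<^sub>0 "y\<^sub>1 # y\<^sub>2 # ys" w] x val ys_level len len_ys
    by (simp add: ws_eq level_def)
qed

text \<open>Any vector \<open>w\<close> with the required projection \<open>v\<^sub>0\<close> can be moved to \<open>v\<close> by an isometry
  fixing \<open>us\<close>.\<close>

lemma orthogonal_frame_with_projection:
  assumes frame: "orthogonal_frame (v # us)" and len: "length us + 4 \<le> CARD('n)" and s: "s \<noteq> 0"
  obtains x v\<^sub>0 ys where "orthogonal_frame (x # v\<^sub>0 # ys @ us)" "length ys + length us + 2 = CARD('n)"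
    "set ys \<subseteq> level (bil v v)" "bil v\<^sub>0 v\<^sub>0 = s * bil v v" "v - v\<^sub>0 \<in> vec.span (set ys)"
proof -
  have us: "orthogonal_frame us" "bil v v \<noteq> 0" using frame by simp_all
  obtain x v\<^sub>0 ys w where x: "orthogonal_frame (x # v\<^sub>0 # ys @ us)"
      "length ys + length us + 2 = CARD('n)"
    and val: "set ys \<subseteq> level (bil v v)" "bil v\<^sub>0 v\<^sub>0 = s * bil v v"
    and w: "w - v\<^sub>0 \<in> vec.span (set ys)" "bil w w = bil v v"
    using ex_orthogonal_frame_resolving[OF us(1) len us(2) s] .
  have "set ys \<subseteq> perp \<sigma> (set us)" "v\<^sub>0 \<in> perp \<sigma> (set us)"
    using x(1) by (auto simp: orthogonal_frame_append mem_perp_iff)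
  then have "(w - v\<^sub>0) + v\<^sub>0 \<in> perp \<sigma> (set us)"
    using w(1) vec.span_minimal[OF _ subspace_perp]
    by (intro vec.subspace_add[OF subspace_perp]) blast+
  then have "orthogonal_frame (w # us)" using us w(2) by simp
  then obtain g where g: "isometry g" "map g (w # us) = v # us"
    by (rule isometry_of_orthogonal_frames[OF _ frame]) (use w(2) in simp)
  then have lin: "Vector_Spaces.linear (*s) (*s) g" by (simp add: isometry_def)
  show thesis
  proof (rule that[of "g x" "g v\<^sub>0" "map g ys"])
    show "orthogonal_frame (g x # g v\<^sub>0 # map g ys @ us)"
    proof -
      have "map g (x # v\<^sub>0 # ys @ us) = g x # g v\<^sub>0 # map g ys @ us" using g(2) by simp
      then show ?thesis using orthogonal_frame_map_isometry[OF g(1)] x(1) by metis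
    qed
    show "set (map g ys) \<subseteq> level (bil v v)" "bil (g v\<^sub>0) (g v\<^sub>0) = s * bil v v"
      using val by (auto simp: level_def bil_isometry[OF g(1)])
    have "v - g v\<^sub>0 = g (w - v\<^sub>0)" using vec.linear_diff[OF lin] g(2) by simp
    then show "v - g v\<^sub>0 \<in> vec.span (set (map g ys))"
      using w(1) by (simp add: vec.linear_span_image[OF lin])
  qed (use x(2) in simp)
qed

lemma card_level_perp_eq_quadric_count:
  assumes frame: "orthogonal_frame (z # x # y # us)" and len: "length us + 3 = CARD('n)"
    and val: "bil z z = - e" "bil x x = \<alpha> * e" "bil y y = \<beta> * e"
  shows "card {u \<in> level e \<inter> perp \<sigma> (set us). bil u z \<noteq> 0} = quadric_count \<alpha> \<beta>"
proof -
  let ?f = "\<lambda>(i, j, t). i *s x + j *s y + t *s z"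
  let ?g = "\<lambda>u. (bil u x / bil x x, bil u y / bil y y, bil u z / bil z z)"
  let ?Q = "{(i, j, t). \<alpha> * i\<^sup>2 + \<beta> * j\<^sup>2 - t\<^sup>2 = 1 \<and> t \<noteq> 0}"
  let ?X = "{u \<in> level e \<inter> perp \<sigma> (set us). bil u z \<noteq> 0}"
  have nz: "e \<noteq> 0" "\<alpha> \<noteq> 0" "\<beta> \<noteq> 0" using frame val by auto
  have perp: "bil z x = 0" "bil x z = 0" "bil z y = 0" "bil y z = 0" "bil x y = 0" "bil y x = 0"
    using frame bil_commute[of x z] bil_commute[of y z] bil_commute[of y x]
    by (auto simp: mem_perp_iff)
  have f_perp: "?f a \<in> perp \<sigma> (set us)" for a
    using frame by (simp add: mem_perp_iff split: prod.split)
  have "bil (?f (i, j, t)) (?f (i, j, t)) = e * (\<alpha> * i\<^sup>2 + \<beta> * j\<^sup>2 - t\<^sup>2)" for i j t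
    using perp val by (simp add: power2_eq_square algebra_simps)
  then have f_level: "?f (i, j, t) \<in> level e \<longleftrightarrow> \<alpha> * i\<^sup>2 + \<beta> * j\<^sup>2 - t\<^sup>2 = 1" for i j t
    unfolding level_def mem_Collect_eq using nz by simp
  have f_g: "?f (?g u) = u" if "u \<in> perp \<sigma> (set us)" for u
    using orthogonal_frame_expansion_three[OF frame len that] by simp
  have "bij_betw ?f ?Q ?X"
  proof (rule bij_betw_byWitness[where f' = ?g])
    show "\<forall>a\<in>?Q. ?g (?f a) = a" using perp val nz by auto
    show "\<forall>u\<in>?X. ?f (?g u) = u" using f_g by blast
    show "?f ` ?Q \<subseteq> ?X"
    proof (rule image_subsetI)
      fix a assume "a \<in> ?Q"
      moreover obtain i j t where "a = (i, j, t)" by (cases a)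
      ultimately show "?f a \<in> ?X" using f_level f_perp[of a] perp val(1) nz by simp
    qed
    show "?g ` ?X \<subseteq> ?Q"
    proof (rule image_subsetI)
      fix u assume u: "u \<in> ?X"
      then have "?f (?g u) \<in> level e" using f_g[of u] by simp
      then show "?g u \<in> ?Q" unfolding f_level using u nz val(1) by simp
    qed
  qed
  then show ?thesis unfolding quadric_count_def by (rule bij_betw_same_card[symmetric])
qed

end

locale projected_tangent_pair = tangent_pair \<sigma> "pt (z + z')" e v\<^sub>1 v\<^sub>2
  for \<sigma> :: "'a::{field,finite} ^ 'n \<Rightarrow> 'a" and z z' e v\<^sub>1 v\<^sub>2 +
  fixes v' v\<^sub>0 x :: "'a ^ 'n" and ys :: "('a ^ 'n) list" and a r s :: 'a
  assumes v\<^sub>1_eq: "v\<^sub>1 = a *s v\<^sub>2 + r *s v'" and r: "r \<noteq> 0" "a\<^sup>2 + r\<^sup>2 = 1"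
    and frame: "orthogonal_frame (x # v\<^sub>0 # ys @ [z', z, v\<^sub>2])"
    and length_ys: "length ys + 5 = CARD('n)"
    and bil_values: "bil z z = e" "bil z' z' = - e" "bil v' v' = e" "bil v\<^sub>0 v\<^sub>0 = s * e"
    and ys_level: "set ys \<subseteq> level e"
    and projection: "v' - v\<^sub>0 \<in> vec.span (set ys)"
    and perp_z: "bil v' z = 0"
    and nonsquare: "\<not> is_square (a\<^sup>2 + r\<^sup>2 * s)"
begin

lemma frame_v\<^sub>2: "orthogonal_frame (z' # v\<^sub>0 # x # v\<^sub>2 # z # ys)"
proof -
  have "mset (z' # v\<^sub>0 # x # v\<^sub>2 # z # ys) = mset (x # v\<^sub>0 # ys @ [z', z, v\<^sub>2])" by simp
  from orthogonal_frame_mset_cong[OF this] show ?thesis using frame by simp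
qed

lemma bil_ys:
  assumes "y \<in> set ys"
  shows "bil y z = 0" "bil y z' = 0" "bil y v\<^sub>0 = 0" "bil y v\<^sub>2 = 0" "bil y x = 0"
    and "bil z y = 0" "bil z' y = 0" "bil v\<^sub>0 y = 0" "bil v\<^sub>2 y = 0" "bil x y = 0"
  using frame_v\<^sub>2 assms by (simp_all add: mem_perp_iff bil_commute[of y])

lemma bil_frame:
  shows "bil z z' = 0" "bil z v\<^sub>0 = 0" "bil z x = 0" "bil z v\<^sub>2 = 0" "bil z' v\<^sub>0 = 0"
    "bil z' x = 0" "bil z' v\<^sub>2 = 0" "bil v\<^sub>0 x = 0" "bil v\<^sub>0 v\<^sub>2 = 0" "bil x v\<^sub>2 = 0"
    and "bil z' z = 0" "bil v\<^sub>0 z = 0" "bil x z = 0" "bil v\<^sub>2 z = 0" "bil v\<^sub>0 z' = 0"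
    "bil x z' = 0" "bil v\<^sub>2 z' = 0" "bil x v\<^sub>0 = 0" "bil v\<^sub>2 v\<^sub>0 = 0" "bil v\<^sub>2 x = 0"
  using frame_v\<^sub>2 by (simp_all add: mem_perp_iff bil_commute)

lemma s_neq: "s \<noteq> 0" "s \<noteq> 1"
  using nonsquare r(2) is_nth_power_1 by auto

lemma bil_v\<^sub>1_right: "bil u v\<^sub>1 = a * bil u v\<^sub>2 + r * bil u v'"
  by (simp add: v\<^sub>1_eq)

lemma mem_perp_p_iff:
  assumes "bil u z = 0"
  shows "u \<in> perp \<sigma> (pt (z + z')) \<longleftrightarrow> bil u z' = 0"
  unfolding perp_pt using assms by (simp add: mem_perp_iff)

lemma bil_v'_eq_bil_v\<^sub>0:
  assumes "u \<in> perp \<sigma> (set ys)"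
  shows "bil u v' = bil u v\<^sub>0"
proof -
  have "u \<in> perp \<sigma> (vec.span (set ys))" using assms by (simp only: perp_span)
  then have "bil u (v' - v\<^sub>0) = 0" using projection by (simp only: mem_perp_iff)
  then show ?thesis by simp
qed

lemma bil_v'_v\<^sub>0: "bil v' v\<^sub>0 = s * e"
  using bil_v'_eq_bil_v\<^sub>0[of v\<^sub>0] bil_ys(8) bil_values(4)
  by (simp add: mem_perp_iff bil_commute[of v'])

lemma ex_ys_bil_v\<^sub>1: "\<exists>y\<in>set ys. bil y v\<^sub>1 \<noteq> 0"
proof (rule ccontr)
  assume none: "\<not> ?thesis"
  have "bil v' y = 0" if "y \<in> set ys" for y
  proof -
    have "bil y v\<^sub>1 = 0" using none that by blast
    then show ?thesis using bil_ys(4)[OF that] r(1)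
      by (simp add: bil_v\<^sub>1_right bil_commute[of v'])
  qed
  then have "bil v' v' = bil v' v\<^sub>0" by (intro bil_v'_eq_bil_v\<^sub>0) (simp add: mem_perp_iff)
  then show False using bil_values(3) bil_v'_v\<^sub>0 s_neq(2) e_nonzero by simp
qed

lemma pt_ys_notin_C\<^sub>1:
  assumes "y \<in> set ys"
  shows "pt y \<notin> C\<^sub>1"
proof
  assume "pt y \<in> C\<^sub>1"
  moreover have "v\<^sub>0 \<in> perp \<sigma> (pt (z + z'))" using bil_frame by (simp add: mem_perp_p_iff)
  ultimately have "bil v\<^sub>1 v\<^sub>0 = 0"
    using bil_coset_point[OF v\<^sub>1, of y v\<^sub>0] assms ys_level bil_ys(3) by blast
  then have "r * (s * e) = 0" by (simp add: v\<^sub>1_eq bil_frame bil_v'_v\<^sub>0)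
  then show False using r(1) s_neq(1) e_nonzero by simp
qed

lemma switched_clique_z_ys: "switched_clique \<sigma> (pt (z + z')) e v\<^sub>1 v\<^sub>2 (z # ys)"
proof
  have ys_perp: "y \<in> perp \<sigma> (pt (z + z'))" if "y \<in> set ys" for y
    using bil_ys(1,2)[OF that] by (simp add: mem_perp_p_iff)
  have z_not_perp: "z \<notin> perp \<sigma> (pt (z + z'))"
    unfolding perp_pt using bil_values(1) bil_frame(1) e_nonzero by (simp add: mem_perp_iff)
  show "orthogonal_frame (v\<^sub>2 # z # ys)" using frame_v\<^sub>2 by simp
  show "set (z # ys) \<subseteq> level e" using ys_level bil_values(1) by (simp add: level_def)
  show "pt k \<notin> C\<^sub>1" if "k \<in> set (z # ys)" for k
    using that coset_point_perp[OF v\<^sub>1, of z] z_not_perp bil_values(1) pt_ys_notin_C\<^sub>1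
    by (auto simp: level_def)
  show "bil k v\<^sub>1 = 0" if "k \<in> set (z # ys)" "k \<notin> perp \<sigma> (pt (z + z'))" for k
    using that ys_perp perp_z by (auto simp: bil_v\<^sub>1_right bil_frame bil_commute[of z v'])
  show "\<exists>k\<in>set (z # ys). k \<in> perp \<sigma> (pt (z + z')) \<and> bil k v\<^sub>1 \<noteq> 0"
    using ex_ys_bil_v\<^sub>1 ys_perp by auto
qed

lemma level_perp_diff_perp_p:
  "level e \<inter> perp \<sigma> (set (v # z # ys)) - perp \<sigma> (pt (z + z'))
    = {u \<in> level e \<inter> perp \<sigma> (set (v # z # ys)). bil u z' \<noteq> 0}"
proof -
  have "bil u z = 0" if "u \<in> perp \<sigma> (set (v # z # ys))" for u
    using that by (simp add: mem_perp_iff)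
  then show ?thesis using mem_perp_p_iff by blast
qed

lemma card_level_perp_v\<^sub>2:
  "card (level e \<inter> perp \<sigma> (set (v\<^sub>2 # z # ys)) - perp \<sigma> (pt (z + z')))
    = quadric_count s (bil x x / e)"
  unfolding level_perp_diff_perp_p using e_nonzero length_ys bil_values
  by (intro card_level_perp_eq_quadric_count[OF frame_v\<^sub>2]) simp_all

text \<open>The projection \<open>x\<^sub>1\<close> of \<open>v\<^sub>1\<close> to \<open>set ys\<^sup>\<bottom>\<close> has value \<open>(a\<^sup>2 + r\<^sup>2 s) e\<close>, and \<open>x\<^sub>0\<close> spans its
  perpendicular space in \<open>\<langle>v\<^sub>2, v\<^sub>0\<rangle>\<close>.\<close>

lemma card_level_perp_v\<^sub>1:
  "card (level e \<inter> perp \<sigma> (set (v\<^sub>1 # z # ys)) - perp \<sigma> (pt (z + z')))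
    = quadric_count (s * (a\<^sup>2 + r\<^sup>2 * s)) (bil x x / e)"
proof -
  define x\<^sub>1 x\<^sub>0 where "x\<^sub>1 = a *s v\<^sub>2 + r *s v\<^sub>0" and "x\<^sub>0 = (r * s) *s v\<^sub>2 - a *s v\<^sub>0"
  have "bil u v\<^sub>1 = bil u x\<^sub>1" if "u \<in> perp \<sigma> (set ys)" for u
    using bil_v'_eq_bil_v\<^sub>0[OF that] by (simp add: bil_v\<^sub>1_right x\<^sub>1_def)
  then have perp_v\<^sub>1: "perp \<sigma> (set (v\<^sub>1 # z # ys)) = perp \<sigma> (set (x\<^sub>1 # z # ys))"
    by (auto simp: mem_perp_iff)
  have "bil x\<^sub>1 x\<^sub>1 = (a\<^sup>2 + r\<^sup>2 * s) * e"
    and value_x\<^sub>0: "bil x\<^sub>0 x\<^sub>0 = s * (a\<^sup>2 + r\<^sup>2 * s) * e" and "bil x\<^sub>0 x\<^sub>1 = 0"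
    by (simp_all add: x\<^sub>1_def x\<^sub>0_def bil_frame bil_values power2_eq_square algebra_simps)
  moreover have "a\<^sup>2 + r\<^sup>2 * s \<noteq> 0" using nonsquare by auto
  moreover have "x\<^sub>1 \<in> perp \<sigma> (set (z # ys))" "x\<^sub>0 \<in> perp \<sigma> (set (x # z # ys))"
    "x \<in> perp \<sigma> (set (x\<^sub>1 # z # ys))" "z' \<in> perp \<sigma> (set (x\<^sub>0 # x # x\<^sub>1 # z # ys))"
    by (simp_all add: x\<^sub>1_def x\<^sub>0_def mem_perp_iff bil_frame bil_ys)
  moreover have "orthogonal_frame (z # ys)" "bil x x \<noteq> 0" using frame_v\<^sub>2 by simp_all
  ultimately have "orthogonal_frame (z' # x\<^sub>0 # x # x\<^sub>1 # z # ys)"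
    using bil_values(2) e_nonzero s_neq(1) by (simp add: mem_perp_iff)
  then have "card {u \<in> level e \<inter> perp \<sigma> (set (x\<^sub>1 # z # ys)). bil u z' \<noteq> 0}
      = quadric_count (s * (a\<^sup>2 + r\<^sup>2 * s)) (bil x x / e)"
    using e_nonzero length_ys bil_values(2) value_x\<^sub>0
    by (intro card_level_perp_eq_quadric_count) simp_all
  then show ?thesis unfolding level_perp_diff_perp_p perp_v\<^sub>1 .
qed

lemma not_graph_iso_projected: "\<not> graph_iso \<Gamma>' \<Gamma>"
proof -
  interpret switched_clique \<sigma> "pt (z + z')" e v\<^sub>1 v\<^sub>2 "z # ys" by (rule switched_clique_z_ys)
  have "bil x x / e \<noteq> 0" using frame_v\<^sub>2 e_nonzero by simp
  from quadric_count_mult_nonsquare_neq[OF two s_neq(1) this nonsquare] show ?thesis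
    unfolding card_level_perp_v\<^sub>1[symmetric] card_level_perp_v\<^sub>2[symmetric]
    by (rule not_graph_iso_switch)
qed

end

context tangent_pair
begin

lemma not_graph_iso_if_hyperbolic:
  assumes card: "CARD('n) \<ge> 7" and p: "p = pt p\<^sub>0"
    and z: "bil z z = e" "bil z p\<^sub>0 = e" "bil v\<^sub>1 z = 0" "bil v\<^sub>2 z = 0"
    and a: "bil v\<^sub>1 v\<^sub>2 = a * e" and r: "r \<noteq> 0" "a\<^sup>2 + r\<^sup>2 = 1"
  shows "\<not> graph_iso \<Gamma>' \<Gamma>"
proof -
  define z' where "z' = p\<^sub>0 - z"
  define v' where "v' = (1 / r) *s (v\<^sub>1 - a *s v\<^sub>2)"
  have p\<^sub>0: "p\<^sub>0 \<in> p" unfolding p by (rule mem_pt)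
  then have "bil p\<^sub>0 p\<^sub>0 = 0" "bil v\<^sub>1 p\<^sub>0 = 0" "bil v\<^sub>2 p\<^sub>0 = 0"
    using v\<^sub>1 v\<^sub>2 by (simp_all add: bil_isotropic bil_perp)
  then have z': "bil z' z' = - e" "bil z' z = 0" "bil v\<^sub>1 z' = 0" "bil v\<^sub>2 z' = 0"
    using z bil_commute[of p\<^sub>0 z] by (simp_all add: z'_def)
  have perp_v': "bil v' z = 0" "bil v' z' = 0" "bil v' v\<^sub>2 = 0"
    using z z' a by (simp_all add: v'_def)
  have "r\<^sup>2 * bil v' v' = (1 - a\<^sup>2) * e"
    using a r(1) bil_commute[of v\<^sub>2 v\<^sub>1] by (simp add: v'_def power2_eq_square algebra_simps)
  also have "1 - a\<^sup>2 = r\<^sup>2" using r(2) by (simp add: algebra_simps)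
  finally have v'_v': "bil v' v' = e" using r(1) by simp
  obtain \<gamma> :: 'a where \<gamma>: "\<not> is_square \<gamma>" using ex_nonsquare[OF two] by blast
  define s where "s = (\<gamma> - a\<^sup>2) / r\<^sup>2"
  have s: "a\<^sup>2 + r\<^sup>2 * s = \<gamma>" using r(1) by (simp add: s_def)
  then have "s \<noteq> 0" using \<gamma> by auto
  moreover have "orthogonal_frame (v' # [z', z, v\<^sub>2])"
    using perp_v' v'_v' z z' e_nonzero
    by (simp add: mem_perp_iff bil_commute[of z v\<^sub>2] bil_commute[of z' v\<^sub>2])
  ultimately obtain x v\<^sub>0 ys where "orthogonal_frame (x # v\<^sub>0 # ys @ [z', z, v\<^sub>2])"
    "length ys + length [z', z, v\<^sub>2] + 2 = CARD('n)"
    "set ys \<subseteq> level (bil v' v')" "bil v\<^sub>0 v\<^sub>0 = s * bil v' v'" "v' - v\<^sub>0 \<in> vec.span (set ys)"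
    using orthogonal_frame_with_projection[of v' "[z', z, v\<^sub>2]" s] card by auto
  moreover have p_eq: "p = pt (z + z')" by (simp add: p z'_def)
  moreover have "v\<^sub>1 = a *s v\<^sub>2 + r *s v'" using r(1) by (simp add: v'_def)
  ultimately have "projected_tangent_pair \<sigma> z z' e v\<^sub>1 v\<^sub>2 v' v\<^sub>0 x ys a r s"
    using tangent_pair_axioms z z' v'_v' perp_v' r s \<gamma>
    by (intro projected_tangent_pair.intro projected_tangent_pair_axioms.intro) simp_all
  from projected_tangent_pair.not_graph_iso_projected[OF this] show ?thesis
    unfolding p_eq .
qed

end


subsection \<open>The induced form on the quotient\<close>

lemma coset_eq_iff_mem:
  fixes p :: "('a::field ^ 'n) set"
  assumes "vec.subspace p"
  shows "v +o p = 0 +o p \<longleftrightarrow> v \<in> p"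
proof
  assume "v +o p = 0 +o p"
  then have "v + 0 \<in> 0 +o p" using vec.subspace_0[OF assms] set_plus_intro2 by blast
  then show "v \<in> p" by simp
next
  assume v: "v \<in> p"
  have "u \<in> v +o p \<longleftrightarrow> u \<in> p" for u
    using vec.subspace_add[OF assms v, of "u - v"] vec.subspace_diff[OF assms _ v, of u]
    by (simp add: set_minus_plus[symmetric]) blast
  then show "v +o p = 0 +o p" by auto
qed

lemma quotient_isometricE:
  fixes \<tau> :: "'a::field ^ 'k \<Rightarrow> 'a" and p P :: "('a ^ 'n) set"
  assumes "quotient_isometric \<sigma> P p \<tau>" and p: "vec.subspace p" and "0 \<in> P"
  obtains \<psi> where "\<And>u v. u \<in> P \<Longrightarrow> v \<in> P \<Longrightarrow> \<psi> (u + v) = \<psi> u + \<psi> v"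
    "\<And>v. v \<in> P \<Longrightarrow> \<tau> (\<psi> v) = \<sigma> v" "\<And>v. v \<in> P \<Longrightarrow> \<psi> v = 0 \<longleftrightarrow> v \<in> p" "\<psi> ` P = UNIV"
proof -
  obtain \<phi> where bij: "bij_betw \<phi> ((\<lambda>v. v +o p) ` P) UNIV"
    and add: "\<forall>u\<in>P. \<forall>v\<in>P. \<phi> ((u + v) +o p) = \<phi> (u +o p) + \<phi> (v +o p)"
    and scale: "\<forall>c. \<forall>v\<in>P. \<phi> ((c *s v) +o p) = c *s \<phi> (v +o p)"
    and form: "\<forall>v\<in>P. \<tau> (\<phi> (v +o p)) = \<sigma> v"
    using assms(1) unfolding quotient_isometric_def by blast
  have zero: "\<phi> (0 +o p) = 0" using scale[rule_format, OF \<open>0 \<in> P\<close>, of 0] by simp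
  have "\<phi> (v +o p) = 0 \<longleftrightarrow> v \<in> p" if "v \<in> P" for v
    using that \<open>0 \<in> P\<close> inj_on_eq_iff[OF bij_betw_imp_inj_on[OF bij], of "v +o p" "0 +o p"]
    unfolding zero coset_eq_iff_mem[OF p] by blast
  moreover have "(\<lambda>v. \<phi> (v +o p)) ` P = UNIV"
    using bij_betw_imp_surj_on[OF bij] by (simp add: image_image)
  ultimately show thesis using that[of "\<lambda>v. \<phi> (v +o p)"] add form by blast
qed

lemma quotient_isometric_radical:
  fixes \<tau> :: "'a::field ^ 'k \<Rightarrow> 'a" and p P :: "('a ^ 'n) set"
  assumes iso: "quotient_isometric \<sigma> P p \<tau>" and sub: "vec.subspace p" "vec.subspace P"
    and "nondegenerate \<tau>"
  shows "P \<inter> perp \<sigma> P \<subseteq> p"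
proof
  obtain \<psi> where \<psi>: "\<And>u v. u \<in> P \<Longrightarrow> v \<in> P \<Longrightarrow> \<psi> (u + v) = \<psi> u + \<psi> v"
    "\<And>v. v \<in> P \<Longrightarrow> \<tau> (\<psi> v) = \<sigma> v" "\<And>v. v \<in> P \<Longrightarrow> \<psi> v = 0 \<longleftrightarrow> v \<in> p" "\<psi> ` P = UNIV"
    using quotient_isometricE[OF iso sub(1) vec.subspace_0[OF sub(2)]] by metis
  fix v assume v: "v \<in> P \<inter> perp \<sigma> P"
  have "polar \<tau> (\<psi> v) (\<psi> u) = 0" if "u \<in> P" for u
  proof -
    have "v + u \<in> P" using v that sub(2) by (simp add: vec.subspace_add)
    then have "polar \<tau> (\<psi> v) (\<psi> u) = polar \<sigma> v u"
      unfolding polar_def using \<psi>(1)[of v u, symmetric] \<psi>(2) v that by simp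
    then show ?thesis using v that by (simp add: perp_def)
  qed
  then have "\<psi> v \<in> perp \<tau> UNIV" unfolding \<psi>(4)[symmetric] by (simp add: perp_def)
  then show "v \<in> p" using assms(4) \<psi>(3) v by (simp add: nondegenerate_def)
qed

lemma quotient_isometric_singular_iff:
  fixes \<tau> :: "'a::field ^ 'k \<Rightarrow> 'a" and p P :: "('a ^ 'n) set"
  assumes iso: "quotient_isometric \<sigma> P p \<tau>" and sub: "vec.subspace p" "vec.subspace P"
  shows "(\<exists>w. w \<noteq> 0 \<and> \<tau> w = 0) \<longleftrightarrow> (\<exists>v\<in>P - p. \<sigma> v = 0)"
proof -
  obtain \<psi> where \<psi>: "\<And>v. v \<in> P \<Longrightarrow> \<tau> (\<psi> v) = \<sigma> v" "\<And>v. v \<in> P \<Longrightarrow> \<psi> v = 0 \<longleftrightarrow> v \<in> p"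
    "\<psi> ` P = UNIV"
    using quotient_isometricE[OF iso sub(1) vec.subspace_0[OF sub(2)]] by metis
  have "(\<exists>w. w \<noteq> 0 \<and> \<tau> w = 0) \<longleftrightarrow> (\<exists>w\<in>\<psi> ` P. w \<noteq> 0 \<and> \<tau> w = 0)" by (simp add: \<psi>(3))
  also have "\<dots> \<longleftrightarrow> (\<exists>v\<in>P - p. \<sigma> v = 0)" using \<psi>(1,2) by auto
  finally show ?thesis .
qed

context tangent_pair
begin

lemma independent_mod_p:
  assumes "c *s v\<^sub>1 + d *s v\<^sub>2 \<in> p"
  shows "c = 0" and "d = 0"
proof -
  let ?w = "c *s v\<^sub>1 + d *s v\<^sub>2"
  have "bil v\<^sub>1 ?w = 0" "bil v\<^sub>2 ?w = 0" using assms v\<^sub>1 v\<^sub>2 bil_perp by blast+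
  then have "c * (c * e) = d * (d * e)"
    using bil_commute[of v\<^sub>2 v\<^sub>1] by simp algebra
  then have sq: "c\<^sup>2 = d\<^sup>2" using e_nonzero by (simp add: power2_eq_square)
  show "c = 0"
  proof (rule ccontr)
    assume c: "c \<noteq> 0"
    have "d = 1 * c \<or> d = - 1 * c" using sq by (auto simp: power2_eq_iff)
    then obtain k where k: "k = 1 \<or> k = -1" "d = k * c" by blast
    have "(1 / c) *s ?w \<in> p" using vec.subspace_scale[OF subspace assms] .
    moreover have "(1 / c) *s ?w = v\<^sub>1 + k *s v\<^sub>2"
      using c k(2) by (simp add: vec_eq_iff field_simps)
    ultimately have w: "v\<^sub>1 + k *s v\<^sub>2 \<in> p" by simp
    have "pt (v\<^sub>1 + - (v\<^sub>1 + k *s v\<^sub>2)) \<in> C\<^sub>1"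
      unfolding coset_points_def by (rule imageI) (rule vec.subspace_neg[OF subspace w])
    moreover have "v\<^sub>1 + - (v\<^sub>1 + k *s v\<^sub>2) = (- k) *s v\<^sub>2" by (simp add: vec_eq_iff)
    moreover have "pt ((- k) *s v\<^sub>2) = pt v\<^sub>2" using k(1) by (intro pt_scale) auto
    ultimately show False using pt_mem_coset_points[of v\<^sub>2] disjoint by (metis IntI empty_iff)
  qed
  with sq show "d = 0" by simp
qed

definition P :: "('a ^ 'n) set" where
  "P = vec.span (insert v\<^sub>1 (insert v\<^sub>2 p))"

lemma P_eq: "P = {c *s v\<^sub>1 + d *s v\<^sub>2 + w | c d w. w \<in> p}"
proof -
  have "v \<in> P \<longleftrightarrow> (\<exists>c d. v - c *s v\<^sub>1 - d *s v\<^sub>2 \<in> p)" for v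
    using subspace by (simp add: P_def vec.span_insert vec.span_eq_iff[THEN iffD2])
  moreover have "(\<exists>w. v = c *s v\<^sub>1 + d *s v\<^sub>2 + w \<and> w \<in> p) \<longleftrightarrow> v - c *s v\<^sub>1 - d *s v\<^sub>2 \<in> p" for v c d
    by (auto intro: exI[of _ "v - c *s v\<^sub>1 - d *s v\<^sub>2"])
  ultimately show ?thesis by blast
qed

lemma P_eq_plus: "P = vec.span (insert v\<^sub>1 p) + vec.span (insert v\<^sub>2 p)"
proof -
  have "P = vec.span (insert v\<^sub>1 p \<union> insert v\<^sub>2 p)"
    unfolding P_def by (rule arg_cong[where f = vec.span]) blast
  then show ?thesis unfolding vec.span_Un set_plus_def by blast
qed

lemma form_P:
  assumes "bil v\<^sub>1 v\<^sub>2 = a * e" "w \<in> p"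
  shows "\<sigma> (c *s v\<^sub>1 + d *s v\<^sub>2 + w) = ((d + a * c)\<^sup>2 - (a\<^sup>2 - 1) * c\<^sup>2) * e"
proof -
  have "bil v\<^sub>2 v\<^sub>1 = a * e" "bil w w = 0" "bil v\<^sub>1 w = 0" "bil v\<^sub>2 w = 0" "bil w v\<^sub>1 = 0" "bil w v\<^sub>2 = 0"
    using assms v\<^sub>1 v\<^sub>2 bil_commute[of v\<^sub>2 v\<^sub>1] by (simp_all add: bil_isotropic bil_perp)
  then show ?thesis
    using assms(1) by (simp add: power2_eq_square algebra_simps flip: bil_self)
qed

lemma ex_singular_iff:
  assumes a: "bil v\<^sub>1 v\<^sub>2 = a * e"
  shows "(\<exists>v\<in>P - p. \<sigma> v = 0) \<longleftrightarrow> is_square (a\<^sup>2 - 1)"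
proof
  assume "\<exists>v\<in>P - p. \<sigma> v = 0"
  then obtain c d w where w: "w \<in> p" and not_p: "c *s v\<^sub>1 + d *s v\<^sub>2 + w \<notin> p"
    and "\<sigma> (c *s v\<^sub>1 + d *s v\<^sub>2 + w) = 0"
    unfolding P_eq by blast
  then have eq: "(d + a * c)\<^sup>2 = (a\<^sup>2 - 1) * c\<^sup>2" using form_P[OF a w, of c d] e_nonzero by simp
  have "c \<noteq> 0" using eq not_p w by auto
  then have "a\<^sup>2 - 1 = ((d + a * c) / c)\<^sup>2" using eq by (simp add: power_divide)
  then show "is_square (a\<^sup>2 - 1)" ..
next
  assume "is_square (a\<^sup>2 - 1)"
  then obtain k where k: "a\<^sup>2 - 1 = k\<^sup>2" by (rule is_nth_powerE)
  let ?v = "1 *s v\<^sub>1 + (k - a) *s v\<^sub>2 + 0"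
  have zero: "0 \<in> p" using vec.subspace_0[OF subspace] .
  have "\<sigma> ?v = 0" unfolding form_P[OF a zero] k by simp
  moreover have "?v \<in> P" unfolding P_eq using zero by blast
  moreover have "?v \<notin> p" using independent_mod_p(1)[of 1 "k - a"] by auto
  ultimately show "\<exists>v\<in>P - p. \<sigma> v = 0" by blast
qed

lemma radical_P_not_subset:
  assumes "bil v\<^sub>1 v\<^sub>2 = a * e" "a\<^sup>2 = 1"
  shows "\<not> P \<inter> perp \<sigma> P \<subseteq> p"
proof -
  let ?v = "1 *s v\<^sub>1 + (- a) *s v\<^sub>2"
  have "?v \<in> P" by (simp add: P_def vec.span_diff vec.span_scale vec.span_base)
  moreover have "?v \<in> perp \<sigma> p"
    using v\<^sub>1 v\<^sub>2 vec.subspace_add[OF subspace_perp] vec.subspace_scale[OF subspace_perp] by blast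
  then have "?v \<in> perp \<sigma> P"
    using assms bil_commute[of v\<^sub>2 v\<^sub>1]
    by (simp add: P_def perp_span mem_perp_iff[of _ "insert _ _"] power2_eq_square)
       (simp add: mem_perp_iff)
  moreover have "?v \<notin> p" using independent_mod_p(1)[of 1 "- a"] by auto
  ultimately show ?thesis by blast
qed

lemma discriminant_square:
  assumes \<tau>: "type_O2 (if CARD('a) mod 4 = 3 then Neg else Pos) \<tau>" "quotient_isometric \<sigma> P p \<tau>"
    and a: "bil v\<^sub>1 v\<^sub>2 = a * e" and odd: "odd CARD('a)"
  obtains r where "r \<noteq> 0" "a\<^sup>2 + r\<^sup>2 = 1"
proof -
  have sub: "vec.subspace P" by (simp add: P_def)
  have "P \<inter> perp \<sigma> P \<subseteq> p"
    using quotient_isometric_radical[OF \<tau>(2) subspace sub] \<tau>(1) by (simp add: type_O2_def)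
  then have nz: "a\<^sup>2 - 1 \<noteq> 0" using radical_P_not_subset[OF a] by auto
  have "is_square (a\<^sup>2 - 1) \<longleftrightarrow> (\<exists>w. w \<noteq> 0 \<and> \<tau> w = 0)"
    unfolding ex_singular_iff[OF a, symmetric]
      quotient_isometric_singular_iff[OF \<tau>(2) subspace sub] ..
  also have "\<dots> \<longleftrightarrow> CARD('a) mod 4 \<noteq> 3" using \<tau>(1) by (auto simp: type_O2_def)
  also have "\<dots> \<longleftrightarrow> CARD('a) mod 4 = 1" using odd by presburger
  also have "\<dots> \<longleftrightarrow> is_square (-1 :: 'a)" using is_square_minus_one_iff[OF two] ..
  finally have "is_square ((-1) * (a\<^sup>2 - 1))" using is_square_mult_iff[OF two _ nz, of "-1"]
    by simp
  then obtain r where r: "(-1) * (a\<^sup>2 - 1) = r\<^sup>2" by (rule is_nth_powerE)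
  show thesis
  proof
    show "r \<noteq> 0" using r nz by auto
    show "a\<^sup>2 + r\<^sup>2 = 1" using r by (simp add: algebra_simps)
  qed
qed

end

lemma (in quadratic_space) ex_hyperbolic_partner:
  assumes "p\<^sub>0 \<noteq> 0" "bil p\<^sub>0 p\<^sub>0 = 0" "c \<noteq> 0"
  obtains z where "bil z p\<^sub>0 = c" "bil z z = d"
proof -
  have "p\<^sub>0 \<notin> perp \<sigma> UNIV" using assms(1) by (simp add: perp_UNIV)
  then obtain u where u: "bil u p\<^sub>0 \<noteq> 0" using bil_commute by (auto simp: mem_perp_iff)
  define t where "t = (c / bil u p\<^sub>0) *s u"
  have t: "bil t p\<^sub>0 = c" "bil p\<^sub>0 t = c" using u bil_commute[of p\<^sub>0 t] by (simp_all add: t_def)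
  show thesis
    by (rule that[of "t + ((d - bil t t) / (2 * c)) *s p\<^sub>0"])
       (use t assms two in \<open>simp_all add: field_simps\<close>)
qed


subsection \<open>Two tangent subspaces\<close>

locale tangent_subspaces = finite_quadratic_space \<sigma>
  for \<sigma> :: "'a::{field,finite} ^ 'n \<Rightarrow> 'a" +
  fixes \<epsilon> :: sign and L\<^sub>1 L\<^sub>2 :: "('a ^ 'n) set"
  assumes subspaces: "vec.subspace L\<^sub>1" "vec.subspace L\<^sub>2"
    and dims: "vec.dim L\<^sub>1 = Suc (vec.dim (L\<^sub>1 \<inter> L\<^sub>2))" "vec.dim L\<^sub>2 = Suc (vec.dim (L\<^sub>1 \<inter> L\<^sub>2))"
    and Int_subset_perp: "L\<^sub>1 \<inter> L\<^sub>2 \<subseteq> perp \<sigma> L\<^sub>1" "L\<^sub>1 \<inter> L\<^sub>2 \<subseteq> perp \<sigma> L\<^sub>2"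
    and signs: "points_diff L\<^sub>1 L\<^sub>2 \<subseteq> points_of_sign \<sigma> \<epsilon>"
      "points_diff L\<^sub>2 L\<^sub>1 \<subseteq> points_of_sign \<sigma> \<epsilon>"
begin

lemma swap: "tangent_subspaces \<sigma> \<epsilon> L\<^sub>2 L\<^sub>1"
  using subspaces dims Int_subset_perp signs by unfold_locales (simp_all only: Int_commute)

lemma subspace_Int: "vec.subspace (L\<^sub>1 \<inter> L\<^sub>2)"
  using vec.subspace_inter[OF subspaces] .

lemma L\<^sub>1_not_subset_L\<^sub>2: "\<not> L\<^sub>1 \<subseteq> L\<^sub>2"
  using dims(1) by (auto simp: Int_absorb2)

lemma of_sign_L\<^sub>1:
  assumes "v \<in> L\<^sub>1" "v \<notin> L\<^sub>2"
  shows "of_sign \<epsilon> (bil v v)"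
proof (rule of_sign_if_pt_mem)
  have "v \<noteq> 0" using assms(2) vec.subspace_0[OF subspaces(2)] by auto
  then have "pt v \<in> points" "pt v \<subseteq> L\<^sub>1" "\<not> pt v \<subseteq> L\<^sub>2"
    using assms subspaces by (auto simp: points_eq_image_pt pt_subset_iff)
  then show "pt v \<in> points_of_sign \<sigma> \<epsilon>" using signs(1) by blast
qed

lemma ex_L\<^sub>1_level:
  assumes "of_sign \<epsilon> e"
  obtains v where "v \<in> L\<^sub>1" "v \<in> level e"
proof -
  obtain u where u: "u \<in> L\<^sub>1" "u \<notin> L\<^sub>2" using L\<^sub>1_not_subset_L\<^sub>2 by blast
  obtain t where t: "t \<noteq> 0" "e = t\<^sup>2 * bil u u"
    using of_sign_eq_square_mult[OF two of_sign_L\<^sub>1[OF u] assms] .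
  show thesis
    using that[of "t *s u"] u(1) t vec.subspace_scale[OF subspaces(1)]
    by (simp add: level_def power2_eq_square)
qed

lemma ex_L\<^sub>1_level_perp:
  assumes e: "of_sign \<epsilon> e" "e \<noteq> 0" and p\<^sub>0: "p\<^sub>0 \<in> L\<^sub>1 \<inter> L\<^sub>2" "bil z p\<^sub>0 = e"
  obtains v where "v \<in> L\<^sub>1" "v \<in> level e" "bil v z = 0"
proof -
  obtain u where u: "u \<in> L\<^sub>1" "u \<in> level e" using ex_L\<^sub>1_level[OF e(1)] .
  have "bil p\<^sub>0 w = 0" "bil w p\<^sub>0 = 0" if "w \<in> L\<^sub>1" for w
    using p\<^sub>0(1) Int_subset_perp(1) that bil_commute[of w p\<^sub>0]
    by (auto simp: subset_iff mem_perp_iff)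
  note perp_p\<^sub>0 = this(1)[OF u(1)] this(2)[OF u(1)] this(1)[of p\<^sub>0]
  show thesis
  proof (rule that[of "u - (bil u z / e) *s p\<^sub>0"])
    show "u - (bil u z / e) *s p\<^sub>0 \<in> L\<^sub>1"
      using u(1) p\<^sub>0(1) vec.subspace_diff[OF subspaces(1)] vec.subspace_scale[OF subspaces(1)]
      by blast
    show "u - (bil u z / e) *s p\<^sub>0 \<in> level e"
      using u(2) perp_p\<^sub>0 p\<^sub>0(1) by (simp add: level_def)
    show "bil (u - (bil u z / e) *s p\<^sub>0) z = 0"
      using p\<^sub>0(2) e(2) by (simp add: bil_commute[of p\<^sub>0 z])
  qed
qed

lemma L\<^sub>1_level_notin_L\<^sub>2:
  assumes "v \<in> L\<^sub>1" "v \<in> level e" "e \<noteq> 0"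
  shows "v \<notin> L\<^sub>2"
proof
  assume "v \<in> L\<^sub>2"
  then have "v \<in> perp \<sigma> L\<^sub>1" using assms(1) Int_subset_perp(1) by blast
  then have "bil v v = 0" using assms(1) by (simp add: mem_perp_iff)
  then show False using assms(2,3) by (simp add: level_def)
qed

lemma points_diff_L\<^sub>1_L\<^sub>2:
  assumes "v \<in> L\<^sub>1" "v \<in> level e" "e \<noteq> 0"
  shows "points_diff L\<^sub>1 L\<^sub>2 = coset_points (L\<^sub>1 \<inter> L\<^sub>2) v"
  using points_diff_hyperplane[OF subspaces dims(1) assms(1) L\<^sub>1_level_notin_L\<^sub>2[OF assms]] .

lemma span_insert_L\<^sub>1:
  assumes "v \<in> L\<^sub>1" "v \<in> level e" "e \<noteq> 0"
  shows "vec.span (insert v (L\<^sub>1 \<inter> L\<^sub>2)) = L\<^sub>1"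
  using span_insert_hyperplane[OF subspace_Int subspaces(1) _ dims(1) assms(1)]
    L\<^sub>1_level_notin_L\<^sub>2[OF assms] by blast

lemma L\<^sub>1_level_perp: "v \<in> L\<^sub>1 \<Longrightarrow> v \<in> level e \<Longrightarrow> v \<in> level e \<inter> perp \<sigma> (L\<^sub>1 \<inter> L\<^sub>2)"
  using Int_subset_perp(1) bil_commute by (auto simp: subset_iff mem_perp_iff)

interpretation swapped: tangent_subspaces \<sigma> \<epsilon> L\<^sub>2 L\<^sub>1 by (rule swap)

lemma tangent_pair_if_level:
  assumes v: "v\<^sub>1 \<in> L\<^sub>1" "v\<^sub>1 \<in> level e" "v\<^sub>2 \<in> L\<^sub>2" "v\<^sub>2 \<in> level e" and e: "e \<noteq> 0"
  shows "tangent_pair \<sigma> (L\<^sub>1 \<inter> L\<^sub>2) e v\<^sub>1 v\<^sub>2"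
proof
  show "vec.subspace (L\<^sub>1 \<inter> L\<^sub>2)" by (rule subspace_Int)
  show "totally_isotropic \<sigma> (L\<^sub>1 \<inter> L\<^sub>2)"
    using Int_subset_perp(1) by (auto simp: totally_isotropic_def perp_def)
  show "v\<^sub>1 \<in> level e \<inter> perp \<sigma> (L\<^sub>1 \<inter> L\<^sub>2)" using L\<^sub>1_level_perp v by blast
  show "v\<^sub>2 \<in> level e \<inter> perp \<sigma> (L\<^sub>1 \<inter> L\<^sub>2)"
    using swapped.L\<^sub>1_level_perp v by (simp add: Int_commute)
  show "coset_points (L\<^sub>1 \<inter> L\<^sub>2) v\<^sub>1 \<inter> coset_points (L\<^sub>1 \<inter> L\<^sub>2) v\<^sub>2 = {}"
    using points_diff_L\<^sub>1_L\<^sub>2[OF v(1,2) e] swapped.points_diff_L\<^sub>1_L\<^sub>2[OF v(3,4) e]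
    by (auto simp: Int_commute)
qed (rule e)

lemma ex_level: obtains e :: 'a where "of_sign \<epsilon> e" "e \<noteq> 0"
proof -
  obtain u where u: "u \<in> L\<^sub>1" "u \<notin> L\<^sub>2" using L\<^sub>1_not_subset_L\<^sub>2 by blast
  show thesis using that[OF of_sign_L\<^sub>1[OF u]] of_sign_L\<^sub>1[OF u] by (simp add: of_sign_def)
qed

theorem switching_set_tangent_subspaces:
  "switching_set (polar_graph \<sigma> \<epsilon>) (points_diff L\<^sub>1 L\<^sub>2) (points_diff L\<^sub>2 L\<^sub>1)"
proof -
  obtain e :: 'a where sign: "of_sign \<epsilon> e" and nz: "e \<noteq> 0" using ex_level .
  obtain v\<^sub>1 where in_L\<^sub>1: "v\<^sub>1 \<in> L\<^sub>1" "v\<^sub>1 \<in> level e" using ex_L\<^sub>1_level[OF sign] .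
  obtain v\<^sub>2 where in_L\<^sub>2: "v\<^sub>2 \<in> L\<^sub>2" "v\<^sub>2 \<in> level e" using swapped.ex_L\<^sub>1_level[OF sign] .
  interpret tangent_pair \<sigma> "L\<^sub>1 \<inter> L\<^sub>2" e v\<^sub>1 v\<^sub>2 by (rule tangent_pair_if_level[OF in_L\<^sub>1 in_L\<^sub>2 nz])
  show ?thesis
    unfolding points_diff_L\<^sub>1_L\<^sub>2[OF in_L\<^sub>1 nz] swapped.points_diff_L\<^sub>1_L\<^sub>2[OF in_L\<^sub>2 nz]
      polar_graph_eq_level_graph[OF sign] Int_commute[of L\<^sub>2]
    by (rule switching_set_coset_points[OF v\<^sub>1 v\<^sub>2 disjoint])
qed

theorem not_graph_iso_tangent_subspaces:
  assumes dim: "vec.dim (L\<^sub>1 \<inter> L\<^sub>2) = 1" and card: "CARD('n) \<ge> 7" and odd: "odd CARD('a)"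
    and \<tau>: "type_O2 (if CARD('a) mod 4 = 3 then Neg else Pos) \<tau>"
      "quotient_isometric \<sigma> (L\<^sub>1 + L\<^sub>2) (L\<^sub>1 \<inter> L\<^sub>2) \<tau>"
  shows "\<not> graph_iso (switch (polar_graph \<sigma> \<epsilon>) (points_diff L\<^sub>1 L\<^sub>2) (points_diff L\<^sub>2 L\<^sub>1))
    (polar_graph \<sigma> \<epsilon>)"
proof -
  let ?p = "L\<^sub>1 \<inter> L\<^sub>2"
  obtain e :: 'a where sign: "of_sign \<epsilon> e" and nz: "e \<noteq> 0" using ex_level .
  have "?p \<in> points" using dim subspace_Int by (simp add: points_def)
  then obtain p\<^sub>0 where p\<^sub>0: "p\<^sub>0 \<noteq> 0" "?p = pt p\<^sub>0" by (auto simp: points_eq_image_pt)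
  have mem: "p\<^sub>0 \<in> L\<^sub>1 \<inter> L\<^sub>2" "p\<^sub>0 \<in> L\<^sub>2 \<inter> L\<^sub>1" using p\<^sub>0(2) mem_pt by blast+
  have "bil p\<^sub>0 p\<^sub>0 = 0" using mem(1) Int_subset_perp(1) by (auto simp: subset_iff mem_perp_iff)
  from ex_hyperbolic_partner[OF p\<^sub>0(1) this nz]
  obtain z where z: "bil z p\<^sub>0 = e" "bil z z = e" by blast
  obtain v\<^sub>1 where in_L\<^sub>1: "v\<^sub>1 \<in> L\<^sub>1" "v\<^sub>1 \<in> level e" "bil v\<^sub>1 z = 0"
    using ex_L\<^sub>1_level_perp[OF sign nz mem(1) z(1)] .
  obtain v\<^sub>2 where in_L\<^sub>2: "v\<^sub>2 \<in> L\<^sub>2" "v\<^sub>2 \<in> level e" "bil v\<^sub>2 z = 0"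
    using swapped.ex_L\<^sub>1_level_perp[OF sign nz mem(2) z(1)] .
  interpret tangent_pair \<sigma> ?p e v\<^sub>1 v\<^sub>2 by (rule tangent_pair_if_level[OF in_L\<^sub>1(1,2) in_L\<^sub>2(1,2) nz])
  have a: "bil v\<^sub>1 v\<^sub>2 = bil v\<^sub>1 v\<^sub>2 / e * e" using nz by simp
  have "P = L\<^sub>1 + L\<^sub>2"
    unfolding P_eq_plus span_insert_L\<^sub>1[OF in_L\<^sub>1(1,2) nz]
    using swapped.span_insert_L\<^sub>1[OF in_L\<^sub>2(1,2) nz] by (simp add: Int_commute)
  with \<tau> obtain r where "r \<noteq> 0" "(bil v\<^sub>1 v\<^sub>2 / e)\<^sup>2 + r\<^sup>2 = 1"
    using discriminant_square[OF _ _ a odd] by metis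
  from not_graph_iso_if_hyperbolic[OF card p\<^sub>0(2) z(2,1) in_L\<^sub>1(3) in_L\<^sub>2(3) a this] show ?thesis
    unfolding points_diff_L\<^sub>1_L\<^sub>2[OF in_L\<^sub>1(1,2) nz] swapped.points_diff_L\<^sub>1_L\<^sub>2[OF in_L\<^sub>2(1,2) nz]
      polar_graph_eq_level_graph[OF sign] Int_commute[of L\<^sub>2] .
qed

end


theorem theorem10:
  fixes \<sigma> :: "'a::{field,finite} ^ 'n \<Rightarrow> 'a"
    and q n d m :: nat
    and \<epsilon> \<delta> :: sign
    and L\<^sub>1 L\<^sub>2 p P :: "('a ^ 'n) set"
    and C\<^sub>1 C\<^sub>2 :: "('a ^ 'n) set set"
  assumes q: "q = CARD('a)" "q \<ge> 3" "odd q"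
    and n: "n = CARD('n)"
    and d: "d \<ge> 2"
    and type: "type_O_odd d \<sigma> \<or> type_O_plus d \<sigma> \<or> type_O_minus d \<sigma>"
    and m: "3 \<le> m" "m \<le> d"
    and L\<^sub>1: "vec.subspace L\<^sub>1" "vec.dim L\<^sub>1 = m - 1" "\<not> totally_isotropic \<sigma> L\<^sub>1"
    and L\<^sub>2: "vec.subspace L\<^sub>2" "vec.dim L\<^sub>2 = m - 1" "\<not> totally_isotropic \<sigma> L\<^sub>2"
    and p: "p = L\<^sub>1 \<inter> L\<^sub>2" "vec.dim p = m - 2"
      "p = L\<^sub>1 \<inter> perp \<sigma> L\<^sub>1" "p = L\<^sub>2 \<inter> perp \<sigma> L\<^sub>2"
    and P: "P = L\<^sub>1 + L\<^sub>2"
    and C\<^sub>1: "C\<^sub>1 = {x \<in> points. x \<subseteq> L\<^sub>1 \<and> \<not> x \<subseteq> L\<^sub>2}"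
    and C\<^sub>2: "C\<^sub>2 = {x \<in> points. x \<subseteq> L\<^sub>2 \<and> \<not> x \<subseteq> L\<^sub>1}"
    and C: "C\<^sub>1 \<union> C\<^sub>2 \<subseteq> points_of_sign \<sigma> \<epsilon>"
    and \<delta>: "\<delta> = (if q mod 4 = 3 then Neg else Pos)"
  shows "switching_set (polar_graph \<sigma> \<epsilon>) C\<^sub>1 C\<^sub>2 \<and>
    (m = 3 \<and> (\<exists>\<tau>. type_O2 \<delta> \<tau> \<and> quotient_isometric \<sigma> P p \<tau>) \<and> n \<ge> 7 \<longrightarrow>
      \<not> graph_iso (switch (polar_graph \<sigma> \<epsilon>) C\<^sub>1 C\<^sub>2) (polar_graph \<sigma> \<epsilon>))"
proof -
  have two: "(2::'a) \<noteq> 0" using q two_neq_zero_if_odd_card[where 'a = 'a] by simp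
  interpret finite_quadratic_space \<sigma>
    using type two by unfold_locales (auto simp: type_O_odd_def type_O_plus_def type_O_minus_def)
  have "vec.dim L\<^sub>1 = Suc (vec.dim p)" "vec.dim L\<^sub>2 = Suc (vec.dim p)"
    using L\<^sub>1(2) L\<^sub>2(2) p(2) m(1) by simp_all
  moreover have "p \<subseteq> perp \<sigma> L\<^sub>1" "p \<subseteq> perp \<sigma> L\<^sub>2"
    using p(3,4) by blast+
  ultimately interpret tangent_subspaces \<sigma> \<epsilon> L\<^sub>1 L\<^sub>2
    using L\<^sub>1(1) L\<^sub>2(1) C unfolding p(1) C\<^sub>1 C\<^sub>2 by unfold_locales simp_all
  show ?thesis
  proof (intro conjI impI)
    show "switching_set (polar_graph \<sigma> \<epsilon>) C\<^sub>1 C\<^sub>2"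
      unfolding C\<^sub>1 C\<^sub>2 by (rule switching_set_tangent_subspaces)
    assume "m = 3 \<and> (\<exists>\<tau>. type_O2 \<delta> \<tau> \<and> quotient_isometric \<sigma> P p \<tau>) \<and> n \<ge> 7"
    then show "\<not> graph_iso (switch (polar_graph \<sigma> \<epsilon>) C\<^sub>1 C\<^sub>2) (polar_graph \<sigma> \<epsilon>)"
      using not_graph_iso_tangent_subspaces p(2) q(1,3) n
      unfolding C\<^sub>1 C\<^sub>2 P p(1) \<delta> by auto
  qed
qed

end
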